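(* Let $(W,P)=(A_n,A_{k-1}\times A_{n-k})$ (with $1\le k\le n$), $(C_n,A_{n-1})$ or $(D_n,A_{n-1})$. Define the degree of an oriented Temperley–Lieb diagram $\lambda d\mu\in\mathbb{ODT}[W,P]$ by assigning a degree to each of its strands and summing over all strands: a northern arc (decorated or not) whose rightmost vertex is labelled by $\vee$ has degree $+1$; a southern arc (decorated or not) whose rightmost vertex is labelled by $\wedge$ has degree $-1$; all other strands have degree $0$ (in particular all propagating strands have degree $0$). Then for any oriented Temperley–Lieb diagram $\lambda d\mu=\mathsf e_{\mathsf T}$, with $\mathsf T\in\mathrm{Path}_{(W,P)}$, we have $\deg(\lambda d\mu)=\deg(\mathsf T)$.
   Context: **Groups, labels, cosets.** $W$ is of type $A_n$, $C_n$ or $D_n$ with simple reflections labelled $s_1,\dots,s_n$ (type $A_n$, along the chain); $s_{1'},s_2,\dots,s_n$ (type $C_n$, along the chain, double bond between $1'$ and $2$); $s_{1''},s_1,s_2,\dots,s_{n-1}$ (type $D_n$, with $1''$ and $1$ both joined to $2$, followed by the chain $2,3,\dots,n-1$). $P$ is generated by all simple reflections except $s_k$, $s_{1'}$, $s_{1''}$ respectively. ${}^PW$ is the set of minimal length representatives of $P\backslash W$ with the Bruhat order, with identity element denoted $\varnothing$. Elements of ${}^PW$ are identified with coset diagrams, i.e. sequences of symbols on points $1,2,\dots$ of a line: type $A_n$: $n+1$ points, $k$ symbols $\wedge$ and $n+1-k$ symbols $\vee$, with $\varnothing=\wedge^k\vee^{n+1-k}$; type $C_n$: $n+1$ points, the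 first labelled $\circ$, the others arbitrary in $\{\wedge,\vee\}$, $\varnothing=\circ\vee^n$; type $D_n$: $n$ points labelled by $\{\wedge,\vee\}$ with an even number of $\wedge$, $\varnothing=\vee^n$. Right multiplication by $s_i$ with $i\geq 1$ unprimed swaps the symbols at points $i,i+1$; $s_{1'}$ interchanges $\wedge\leftrightarrow\vee$ at point 2; $s_{1''}$ swaps the symbols at points 1 and 2 and then interchanges $\wedge\leftrightarrow\vee$ at both. For $\lambda\in{}^PW$, $\lambda s_i\in{}^PW$ iff this changes the diagram. **Paths.** $\widehat{\mathcal G}_{(W,P)}$ has vertex set ${}^PW$ and, whenever $\lambda,\lambda s_i\in{}^PW$, edges $\lambda\xrightarrow{i}\lambda$ and $\lambda\xrightarrow{i}\lambda s_i$. $\mathrm{Path}_{(W,P)}$ is the set of finite paths. Degrees: $\deg(\lambda\xrightarrow{i}\lambda s_i)=0$; $\deg(\lambda\xrightarrow{i}\lambda)=1$ if $\lambda s_i>\lambda$ and $-1$ if $\lambda s_i<\lambda$; $\deg(\mathsf T)$ is the sum of the degrees of the edges of $\mathsf T$. **Tangles.** An $N$-tangle is a rectangle with $N$ northern and $N$ southern vertices paired off by $N$ non-crossing strands, together with finitely many non-crossing closed loops; a strand or loop may carry finitely many beads if it is left-exposed (can be deformed to touch the left edge). Tangles are taken up to isotopy fixing the boundary. Decorated means carrying a bead. A strand joining north to south is propagating; a strand joining two northern (southern) vertices is a northern (southern) arc. $N=n+1$ in types $A_n,C_n$ and $N=n$ in type $D_n$. $\mathsf e_i$ ($i\ge1$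 unprimed) is the undecorated tangle with arcs joining northern vertices $i,i+1$ and southern vertices $i,i+1$ and vertical strands elsewhere; $\mathsf e_{1'}=\mathsf e_{1''}$ is $\mathsf e_1$ with one bead on each of the two arcs. $\mathbb{DT}[A_n]$: undecorated tangles without loops. $\mathbb{DT}[C_n]$: tangles without loops, at most one bead per strand, satisfying one of: (1) the leftmost northern and leftmost southern vertices are joined by an undecorated strand; (2) they are joined by a decorated strand and there is at least one northern and one southern arc; (3) the strands at the leftmost northern and leftmost southern vertices are distinct and both decorated. $\mathbb{DT}[D_n]$: tangles with at most one bead on each strand or loop and either (1) exactly one loop, which is decorated, no other beads, and at least one northern and one southern arc, or (2) no loops and an even number of beads. **Oriented tangles.** For $d\in\mathbb{DT}[W]$ and $\lambda,\mu\in{}^PW$, $\lambda d\mu$ denotes $d$ with $\lambda$ placed on the southern and $\mu$ on the northern edge. A strand with both ends in $\{\wedge,\vee\}$ is oriented if one arrow points into and one out of the strand (different symbols for an arc, equal symbols for a propagating strand), and flip-oriented otherwise; a strand joining $\circ$ to a symbol of $\{\wedge,\vee\}$ is regarded as both. $\lambda d\mu$ is an oriented tangle (oriented Temperley–Lieb diagram) of type $(W,P)$ if every undecorated strand with an end in $\{\wedge,\vee\}$ is oriented, and moreover: for $(D_n,A_{n-1})$, every decorated strand is flip-oriented and there are no loops; for $(C_n,A_{n-1})$, there is no bead on a strand joining $\circ$ to $\circ$. $\mathbb{ODT}[W,P]$ is the set of these. **Diagrammatic algebra.** $\mathrm{TL}^{\wedge\vee}_{(W,P)}(q)$ is the $\mathbb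 Z[q,q^{-1}]$-algebra with basis $\mathbb{ODT}[W,P]$ and product: $(\lambda d\mu)(\lambda'd'\mu')=0$ if $\mu\ne\lambda'$; if $\mu=\lambda'$ it is the vertical concatenation with $d'$ above $d$, where first each closed loop (with or without beads) is removed and replaced by the scalar $q$ if its rightmost vertex (on the middle line) is labelled $\vee$ and by $q^{-1}$ if labelled $\wedge$; then the middle symbols are deleted, and: in type $C_n$ two beads on a strand equal one bead, and beads on a strand joining $\circ$ to $\circ$ are removed; in type $D_n$ two beads on a strand cancel. For a path $\mathsf T:\lambda_1\xrightarrow{i_1}\lambda_2\cdots\xrightarrow{i_r}\lambda_{r+1}$, $\mathsf e_{\mathsf T}=(\lambda_1\mathsf e_{i_1}\lambda_2)(\lambda_2\mathsf e_{i_2}\lambda_3)\cdots(\lambda_r\mathsf e_{i_r}\lambda_{r+1})$ (and $\lambda_1\mathsf 1\lambda_1$, with $\mathsf 1$ the tangle of vertical undecorated strands, for the trivial path). *)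

theory Defs
  imports
    "HOL-Library.Multiset"
    "HOL-Library.Poly_Mapping"
    "HOL-Combinatorics.Transposition"
    "Graph_Theory.Arc_Walk"
begin

section \<open>The Weyl groups and the minimal coset representatives\<close>

text \<open>
  The pairs \<open>(W, P)\<close>: \<open>TypeA n k\<close> is \<open>(A\<^sub>n, A\<^sub>k\<^sub>-\<^sub>1 \<times> A\<^sub>n\<^sub>-\<^sub>k)\<close>, \<open>TypeC n\<close> is \<open>(C\<^sub>n, A\<^sub>n\<^sub>-\<^sub>1)\<close> and
  \<open>TypeD n\<close> is \<open>(D\<^sub>n, A\<^sub>n\<^sub>-\<^sub>1)\<close>.
\<close>

datatype pair_type = TypeA nat nat | TypeC nat | TypeD nat

fun valid_pair :: "pair_type \<Rightarrow> bool" where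
  "valid_pair (TypeA n k) \<longleftrightarrow> 1 \<le> k \<and> k \<le> n"
| "valid_pair (TypeC n) \<longleftrightarrow> 1 \<le> n"
| "valid_pair (TypeD n) \<longleftrightarrow> 2 \<le> n"

fun num_points :: "pair_type \<Rightarrow> nat" where
  "num_points (TypeA n k) = n + 1"
| "num_points (TypeC n) = n + 1"
| "num_points (TypeD n) = n"

text \<open>Labels of the simple reflections: \<open>Unprimed i\<close>, \<open>Primed\<close>, \<open>DPrimed\<close> are \<open>i\<close>, \<open>1'\<close>, \<open>1''\<close>.\<close>

datatype slabel = Unprimed nat | Primed | DPrimed

fun labels :: "pair_type \<Rightarrow> slabel set" where
  "labels (TypeA n k) = Unprimed ` {1..n}"
| "labels (TypeC n) = insert Primed (Unprimed ` {2..n})"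
| "labels (TypeD n) = insert DPrimed (Unprimed ` {1..n-1})"

fun crossed_label :: "pair_type \<Rightarrow> slabel" where
  "crossed_label (TypeA n k) = Unprimed k"
| "crossed_label (TypeC n) = Primed"
| "crossed_label (TypeD n) = DPrimed"

text \<open>
  The groups are realised as groups of permutations \<open>w\<close> of the integers (the signed points of the
  line) with \<open>w (-x) = - w x\<close>: permutations of the points \<open>1, \<dots>, n+1\<close> in type A, signed permutations
  of the points \<open>2, \<dots>, n+1\<close> in type C, and evenly signed permutations of \<open>1, \<dots>, n\<close> in type D.
  The product of \<open>u\<close> and \<open>v\<close> is \<open>u \<circ> v\<close>.
\<close>

type_synonym welt = "int \<Rightarrow> int"

fun simple_refl :: "slabel \<Rightarrow> welt" where
  "simple_refl (Unprimed i) =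
     transpose (int i) (int i + 1) \<circ> transpose (- int i) (- int i - 1)"
| "simple_refl Primed = transpose 2 (-2)"
| "simple_refl DPrimed = transpose 1 (-2) \<circ> transpose 2 (-1)"

definition word_product :: "slabel list \<Rightarrow> welt" where
  "word_product is = foldr (\<lambda>i w. simple_refl i \<circ> w) is id"

definition weyl_group :: "pair_type \<Rightarrow> welt set" where
  "weyl_group t = {word_product is |is. set is \<subseteq> labels t}"

definition parabolic :: "pair_type \<Rightarrow> welt set" where
  "parabolic t = {word_product is |is. set is \<subseteq> labels t - {crossed_label t}}"

definition coxeter_length :: "pair_type \<Rightarrow> welt \<Rightarrow> nat" where
  "coxeter_length t w =
     (LEAST l. \<exists>is. set is \<subseteq> labels t \<and> word_product is = w \<and> length is = l)"

definition min_reps :: "pair_type \<Rightarrow> welt set" where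
  "min_reps t =
     {w \<in> weyl_group t. \<forall>p \<in> parabolic t. coxeter_length t w \<le> coxeter_length t (p \<circ> w)}"

definition reflections :: "pair_type \<Rightarrow> welt set" where
  "reflections t = {w \<circ> simple_refl i \<circ> inv w |w i. w \<in> weyl_group t \<and> i \<in> labels t}"

definition bruhat_step :: "pair_type \<Rightarrow> welt \<Rightarrow> welt \<Rightarrow> bool" where
  "bruhat_step t u v \<longleftrightarrow> u \<in> weyl_group t \<and>
     (\<exists>r \<in> reflections t. v = u \<circ> r) \<and> coxeter_length t u < coxeter_length t v"

definition bruhat_less :: "pair_type \<Rightarrow> welt \<Rightarrow> welt \<Rightarrow> bool" where
  "bruhat_less t = (bruhat_step t)\<^sup>+\<^sup>+"


section \<open>Coset diagrams\<close>

datatype symbol = Up | Down | Circ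

fun flip :: "symbol \<Rightarrow> symbol" where
  "flip Up = Down"
| "flip Down = Up"
| "flip Circ = Circ"

fun empty_diagram :: "pair_type \<Rightarrow> nat \<Rightarrow> symbol" where
  "empty_diagram (TypeA n k) i = (if i \<le> k then Up else Down)"
| "empty_diagram (TypeC n) i = (if i = 1 then Circ else Down)"
| "empty_diagram (TypeD n) i = Down"

text \<open>
  The coset diagram of \<open>w\<close>, obtained from the empty diagram by the right action of \<open>w\<close>; a diagram
  is extended to negative points by putting the flipped symbol of \<open>i\<close> at \<open>-i\<close>. The lemmas below
  confirm that right multiplication by the simple reflections acts on the symbols as it should.
  Only the points \<open>1, \<dots>, num_points t\<close> are meaningful.
\<close>

definition coset_diagram :: "pair_type \<Rightarrow> welt \<Rightarrow> nat \<Rightarrow> symbol" where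
  "coset_diagram t w i =
     (let x = w (int i)
      in if x > 0 then empty_diagram t (nat x) else flip (empty_diagram t (nat (- x))))"

lemma simple_refl_uminus:
  assumes "i \<in> labels t"
  shows "simple_refl i (- x) = - simple_refl i x"
  using assms by (cases i; cases t) (auto simp: transpose_def)

lemma simple_refl_nonzero:
  assumes "i \<in> labels t"
  shows "simple_refl i x = 0 \<longleftrightarrow> x = 0"
  using assms by (cases i; cases t) (auto simp: transpose_def)

lemma weyl_group_odd:
  assumes "w \<in> weyl_group t"
  shows "w (- x) = - w x" and "w x = 0 \<longleftrightarrow> x = 0"
proof -
  obtain "is" where "set is \<subseteq> labels t" and w: "w = word_product is"
    using assms by (auto simp: weyl_group_def)
  then have "(\<forall>x. word_product is (- x) = - word_product is x) \<and>
             (\<forall>x. word_product is x = 0 \<longleftrightarrow> x = 0)"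
    by (induction "is" arbitrary: w)
       (simp_all add: word_product_def simple_refl_uminus[where t = t] simple_refl_nonzero[where t = t])
  then show "w (- x) = - w x" and "w x = 0 \<longleftrightarrow> x = 0"
    using w by auto
qed

lemma coset_diagram_id:
  "i \<ge> 1 \<Longrightarrow> coset_diagram t id i = empty_diagram t i"
  by (simp add: coset_diagram_def)

lemma coset_diagram_Unprimed:
  assumes "i \<ge> 1" "j \<ge> 1"
  shows "coset_diagram t (w \<circ> simple_refl (Unprimed i)) j =
           coset_diagram t w (if j = i then i + 1 else if j = i + 1 then i else j)"
  using assms by (auto simp: coset_diagram_def transpose_def algebra_simps Let_def)

lemma flip_flip [simp]: "flip (flip s) = s"
  by (cases s) auto

lemma coset_diagram_Primed:
  assumes "w \<in> weyl_group t" "j \<ge> 1"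
  shows "coset_diagram t (w \<circ> simple_refl Primed) j =
           (if j = 2 then flip (coset_diagram t w 2) else coset_diagram t w j)"
  using weyl_group_odd[OF assms(1), of 2] assms(2)
  by (auto simp: coset_diagram_def transpose_def Let_def)

lemma coset_diagram_DPrimed:
  assumes "w \<in> weyl_group t" "j \<ge> 1"
  shows "coset_diagram t (w \<circ> simple_refl DPrimed) j =
           (if j = 1 then flip (coset_diagram t w 2)
            else if j = 2 then flip (coset_diagram t w 1) else coset_diagram t w j)"
  using weyl_group_odd[OF assms(1), of 2] weyl_group_odd[OF assms(1), of 1] assms(2)
  by (auto simp: coset_diagram_def transpose_def Let_def)


section \<open>Paths\<close>

text \<open>The arc \<open>(\<lambda>, i, \<mu>)\<close> is the edge from \<open>\<lambda>\<close> to \<open>\<mu>\<close> with label \<open>i\<close>.\<close>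

type_synonym edge = "welt \<times> slabel \<times> welt"

definition path_graph :: "pair_type \<Rightarrow> (welt, edge) pre_digraph" where
  "path_graph t =
     \<lparr> verts = min_reps t,
       arcs = {(lam, i, mu). i \<in> labels t \<and> lam \<in> min_reps t \<and> lam \<circ> simple_refl i \<in> min_reps t \<and>
                             (mu = lam \<or> mu = lam \<circ> simple_refl i)},
       tail = (\<lambda>(lam, i, mu). lam),
       head = (\<lambda>(lam, i, mu). mu) \<rparr>"

text \<open>A path is recorded with its starting vertex, so that there is a trivial path at each vertex.\<close>

definition paths :: "pair_type \<Rightarrow> (welt \<times> edge awalk) set" where
  "paths t = {(u, p). \<exists>v. pre_digraph.awalk (path_graph t) u p v}"

fun edge_degree :: "pair_type \<Rightarrow> edge \<Rightarrow> int" where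
  "edge_degree t (lam, i, mu) =
     (if mu \<noteq> lam then 0
      else if bruhat_less t lam (lam \<circ> simple_refl i) then 1
      else if bruhat_less t (lam \<circ> simple_refl i) lam then -1
      else 0)"

definition path_degree :: "pair_type \<Rightarrow> welt \<times> edge awalk \<Rightarrow> int" where
  "path_degree t T = sum_list (map (edge_degree t) (snd T))"


section \<open>Tangles\<close>

text \<open>
  An isotopy class of tangles is recorded by its strands (the sets of their two end vertices), the
  number of beads on each strand, and the multiset of the bead numbers of its loops. The
  position of loops relative to the strands is not recorded: the only tangles with loops used
  below have a single loop, which is decorated and hence lies in the region at the left edge.
\<close>

datatype vertex = North nat | South nat

fun column :: "vertex \<Rightarrow> nat" where
  "column (North i) = i"
| "column (South i) = i"

datatype tangle =
  Tangle (strands: "vertex set set") (beads: "vertex set \<Rightarrow> nat") (loops: "nat multiset")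

definition vertices :: "nat \<Rightarrow> vertex set" where
  "vertices N = North ` {1..N} \<union> South ` {1..N}"

text \<open>
  The position of a vertex along the boundary of the rectangle, clockwise from the left edge.
  Two strands cross iff their end vertices are interlaced in this order, and a strand is
  separated from the left edge iff its ends lie between the ends of another strand.
\<close>

fun boundary_pos :: "nat \<Rightarrow> vertex \<Rightarrow> nat" where
  "boundary_pos N (North i) = i"
| "boundary_pos N (South i) = 2 * N + 1 - i"

definition crossing :: "nat \<Rightarrow> vertex set \<Rightarrow> vertex set \<Rightarrow> bool" where
  "crossing N s s' \<longleftrightarrow> (\<exists>a\<in>s. \<exists>b\<in>s'. \<exists>c\<in>s. \<exists>d\<in>s'.
     boundary_pos N a < boundary_pos N b \<and> boundary_pos N b < boundary_pos N c \<and>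
     boundary_pos N c < boundary_pos N d)"

definition left_exposed :: "nat \<Rightarrow> tangle \<Rightarrow> vertex set \<Rightarrow> bool" where
  "left_exposed N d s \<longleftrightarrow> \<not> (\<exists>s'\<in>strands d. \<exists>a\<in>s'. \<exists>b\<in>s'. \<forall>x\<in>s.
     boundary_pos N a < boundary_pos N x \<and> boundary_pos N x < boundary_pos N b)"

definition is_tangle :: "nat \<Rightarrow> tangle \<Rightarrow> bool" where
  "is_tangle N d \<longleftrightarrow>
     \<Union> (strands d) = vertices N \<and> pairwise disjnt (strands d) \<and>
     (\<forall>s\<in>strands d. card s = 2) \<and>
     (\<forall>s\<in>strands d. \<forall>s'\<in>strands d. \<not> crossing N s s') \<and>
     (\<forall>s. beads d s > 0 \<longrightarrow> s \<in> strands d \<and> left_exposed N d s)"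

definition northern_arc :: "vertex set \<Rightarrow> bool" where
  "northern_arc s \<longleftrightarrow> s \<subseteq> range North"

definition southern_arc :: "vertex set \<Rightarrow> bool" where
  "southern_arc s \<longleftrightarrow> s \<subseteq> range South"

definition has_both_arcs :: "tangle \<Rightarrow> bool" where
  "has_both_arcs d \<longleftrightarrow> (\<exists>s\<in>strands d. northern_arc s) \<and> (\<exists>s\<in>strands d. southern_arc s)"

definition id_tangle :: "nat \<Rightarrow> tangle" where
  "id_tangle N = Tangle ((\<lambda>j. {North j, South j}) ` {1..N}) (\<lambda>_. 0) {#}"

text \<open>The tangle \<open>e\<^sub>i\<close> with \<open>b\<close> beads on each of its two arcs.\<close>

definition cup_cap :: "nat \<Rightarrow> nat \<Rightarrow> nat \<Rightarrow> tangle" where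
  "cup_cap N i b =
     Tangle ({{North i, North (i+1)}, {South i, South (i+1)}} \<union>
               (\<lambda>j. {North j, South j}) ` ({1..N} - {i, i+1}))
            (\<lambda>s. if s \<in> {{North i, North (i+1)}, {South i, South (i+1)}} then b else 0)
            {#}"

fun gen_tangle :: "nat \<Rightarrow> slabel \<Rightarrow> tangle" where
  "gen_tangle N (Unprimed i) = cup_cap N i 0"
| "gen_tangle N Primed = cup_cap N 1 1"
| "gen_tangle N DPrimed = cup_cap N 1 1"

fun DT :: "pair_type \<Rightarrow> tangle set" where
  "DT (TypeA n k) =
     {d. is_tangle (n+1) d \<and> loops d = {#} \<and> (\<forall>s\<in>strands d. beads d s = 0)}"
| "DT (TypeC n) =
     {d. is_tangle (n+1) d \<and> loops d = {#} \<and> (\<forall>s\<in>strands d. beads d s \<le> 1) \<and>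
         ( {North 1, South 1} \<in> strands d \<and> beads d {North 1, South 1} = 0
         \<or> {North 1, South 1} \<in> strands d \<and> beads d {North 1, South 1} = 1 \<and> has_both_arcs d
         \<or> (\<exists>s\<in>strands d. \<exists>s'\<in>strands d. North 1 \<in> s \<and> South 1 \<in> s' \<and> s \<noteq> s' \<and>
              beads d s = 1 \<and> beads d s' = 1))}"
| "DT (TypeD n) =
     {d. is_tangle n d \<and> (\<forall>s\<in>strands d. beads d s \<le> 1) \<and>
         ( loops d = {#1#} \<and> (\<forall>s\<in>strands d. beads d s = 0) \<and> has_both_arcs d
         \<or> loops d = {#} \<and> even (\<Sum>s\<in>strands d. beads d s))}"


section \<open>Oriented tangles\<close>

text \<open>The triple \<open>(\<lambda>, d, \<mu>)\<close> is \<open>\<lambda>d\<mu>\<close>, with \<open>\<lambda>\<close> on the southern and \<open>\<mu>\<close> on the northern edge of \<open>d\<close>.\<close>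

type_synonym otangle = "welt \<times> tangle \<times> welt"

fun symbol_at :: "pair_type \<Rightarrow> otangle \<Rightarrow> vertex \<Rightarrow> symbol" where
  "symbol_at t (lam, d, mu) (North i) = coset_diagram t mu i"
| "symbol_at t (lam, d, mu) (South i) = coset_diagram t lam i"

text \<open>Whether the arrow (\<open>\<or>\<close> pointing down, \<open>\<and>\<close> pointing up) at a vertex points into the tangle.\<close>

fun inward :: "vertex \<Rightarrow> symbol \<Rightarrow> bool" where
  "inward (North i) s \<longleftrightarrow> s = Down"
| "inward (South i) s \<longleftrightarrow> s = Up"

definition has_circ :: "pair_type \<Rightarrow> otangle \<Rightarrow> vertex set \<Rightarrow> bool" where
  "has_circ t x s \<longleftrightarrow> Circ \<in> symbol_at t x ` s"

definition circ_circ :: "pair_type \<Rightarrow> otangle \<Rightarrow> vertex set \<Rightarrow> bool" where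
  "circ_circ t x s \<longleftrightarrow> symbol_at t x ` s = {Circ}"

definition oriented :: "pair_type \<Rightarrow> otangle \<Rightarrow> vertex set \<Rightarrow> bool" where
  "oriented t x s \<longleftrightarrow> \<not> circ_circ t x s \<and> (has_circ t x s \<or>
     (\<forall>a\<in>s. \<forall>b\<in>s. a \<noteq> b \<longrightarrow> inward a (symbol_at t x a) \<noteq> inward b (symbol_at t x b)))"

definition flip_oriented :: "pair_type \<Rightarrow> otangle \<Rightarrow> vertex set \<Rightarrow> bool" where
  "flip_oriented t x s \<longleftrightarrow> \<not> circ_circ t x s \<and> (has_circ t x s \<or>
     (\<forall>a\<in>s. \<forall>b\<in>s. a \<noteq> b \<longrightarrow> inward a (symbol_at t x a) = inward b (symbol_at t x b)))"

fun type_condition :: "pair_type \<Rightarrow> otangle \<Rightarrow> bool" where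
  "type_condition (TypeA n k) (lam, d, mu) \<longleftrightarrow> True"
| "type_condition (TypeC n) (lam, d, mu) \<longleftrightarrow>
     (\<forall>s\<in>strands d. circ_circ (TypeC n) (lam, d, mu) s \<longrightarrow> beads d s = 0)"
| "type_condition (TypeD n) (lam, d, mu) \<longleftrightarrow>
     (\<forall>s\<in>strands d. beads d s > 0 \<longrightarrow> flip_oriented (TypeD n) (lam, d, mu) s) \<and> loops d = {#}"

definition ODT :: "pair_type \<Rightarrow> otangle set" where
  "ODT t = {(lam, d, mu). lam \<in> min_reps t \<and> mu \<in> min_reps t \<and> d \<in> DT t \<and>
     (\<forall>s\<in>strands d. beads d s = 0 \<and> \<not> circ_circ t (lam, d, mu) s \<longrightarrow> oriented t (lam, d, mu) s) \<and>
     type_condition t (lam, d, mu)}"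

definition strand_degree :: "pair_type \<Rightarrow> otangle \<Rightarrow> vertex set \<Rightarrow> int" where
  "strand_degree t x s =
     (let rightmost = (THE v. v \<in> s \<and> column v = Max (column ` s))
      in if northern_arc s \<and> symbol_at t x rightmost = Down then 1
         else if southern_arc s \<and> symbol_at t x rightmost = Up then -1
         else 0)"

fun otangle_degree :: "pair_type \<Rightarrow> otangle \<Rightarrow> int" where
  "otangle_degree t (lam, d, mu) = (\<Sum>s\<in>strands d. strand_degree t (lam, d, mu) s)"


section \<open>Vertical concatenation\<close>

text \<open>
  \<open>d'\<close> is placed above \<open>d\<close>; the vertices of the resulting picture lie on its bottom, middle and top
  lines. The pieces of the strands of \<open>d\<close> and \<open>d'\<close> are glued along the middle line, and the
  resulting strands and closed loops correspond to the connected components.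
\<close>

datatype stack_vertex = Bot nat | Mid nat | Top nat

fun in_lower :: "vertex \<Rightarrow> stack_vertex" where
  "in_lower (North i) = Mid i"
| "in_lower (South i) = Bot i"

fun in_upper :: "vertex \<Rightarrow> stack_vertex" where
  "in_upper (North i) = Top i"
| "in_upper (South i) = Mid i"

definition stack_connected :: "tangle \<Rightarrow> tangle \<Rightarrow> (stack_vertex \<times> stack_vertex) set" where
  "stack_connected d d' =
     {(a, b). (\<exists>s\<in>strands d. {a, b} \<subseteq> in_lower ` s) \<or> (\<exists>s\<in>strands d'. {a, b} \<subseteq> in_upper ` s)}\<^sup>*"

definition components :: "tangle \<Rightarrow> tangle \<Rightarrow> stack_vertex set set" where
  "components d d' =
     (\<Union> ((`) in_lower ` strands d) \<union> \<Union> ((`) in_upper ` strands d')) // stack_connected d d'"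

definition end_vertices :: "stack_vertex set \<Rightarrow> vertex set" where
  "end_vertices K = {South i |i. Bot i \<in> K} \<union> {North i |i. Top i \<in> K}"

definition closed_components :: "tangle \<Rightarrow> tangle \<Rightarrow> stack_vertex set set" where
  "closed_components d d' = {K \<in> components d d'. end_vertices K = {}}"

definition component_beads :: "tangle \<Rightarrow> tangle \<Rightarrow> stack_vertex set \<Rightarrow> nat" where
  "component_beads d d' K =
     (\<Sum>s\<in>{s \<in> strands d. in_lower ` s \<subseteq> K}. beads d s) +
     (\<Sum>s\<in>{s \<in> strands d'. in_upper ` s \<subseteq> K}. beads d' s)"

definition open_strands :: "tangle \<Rightarrow> tangle \<Rightarrow> vertex set set" where
  "open_strands d d' = end_vertices ` (components d d' - closed_components d d')"

definition open_beads :: "tangle \<Rightarrow> tangle \<Rightarrow> vertex set \<Rightarrow> nat" where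
  "open_beads d d' s =
     (\<Sum>K\<in>{K \<in> components d d' - closed_components d d'. end_vertices K = s}.
        component_beads d d' K)"

fun reduce_beads :: "pair_type \<Rightarrow> otangle \<Rightarrow> vertex set \<Rightarrow> nat \<Rightarrow> nat" where
  "reduce_beads (TypeA n k) x s b = b"
| "reduce_beads (TypeC n) x s b = (if circ_circ (TypeC n) x s then 0 else min b 1)"
| "reduce_beads (TypeD n) x s b = b mod 2"

text \<open>The concatenation after removal of the closed loops and reduction of the beads.\<close>

definition concat_otangle :: "pair_type \<Rightarrow> otangle \<Rightarrow> otangle \<Rightarrow> otangle" where
  "concat_otangle t x y =
     (case (x, y) of ((lam, d, mu), (mu', d', nu)) \<Rightarrow>
        let raw = (lam, Tangle (open_strands d d') (open_beads d d') {#}, nu)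
        in (lam,
            Tangle (open_strands d d') (\<lambda>s. reduce_beads t raw s (open_beads d d' s)) {#},
            nu))"


section \<open>The diagrammatic algebra\<close>

text \<open>
  Laurent polynomials in \<open>q\<close> over the integers are finitely supported functions on the exponents,
  with the convolution product.
\<close>

type_synonym laurent = "int \<Rightarrow>\<^sub>0 int"

definition q :: laurent where
  "q = Poly_Mapping.single 1 1"

definition q_inv :: laurent where
  "q_inv = Poly_Mapping.single (-1) 1"

text \<open>
  Formal linear combinations of oriented tangles; the algebra consists of those supported
  on \<open>ODT t\<close>.
\<close>

type_synonym tl_elt = "otangle \<Rightarrow>\<^sub>0 laurent"

definition tl_algebra :: "pair_type \<Rightarrow> tl_elt set" where
  "tl_algebra t = {x. Poly_Mapping.keys x \<subseteq> ODT t}"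

definition basis_elt :: "otangle \<Rightarrow> tl_elt" where
  "basis_elt x = Poly_Mapping.single x 1"

definition loop_scalar :: "pair_type \<Rightarrow> welt \<Rightarrow> stack_vertex set \<Rightarrow> laurent" where
  "loop_scalar t mu K = (if coset_diagram t mu (Max {i. Mid i \<in> K}) = Down then q else q_inv)"

fun basis_mult :: "pair_type \<Rightarrow> otangle \<Rightarrow> otangle \<Rightarrow> tl_elt" where
  "basis_mult t (lam, d, mu) (mu', d', nu) =
     (if mu \<noteq> mu' then 0
      else Poly_Mapping.single (concat_otangle t (lam, d, mu) (mu', d', nu))
             (\<Prod>K\<in>closed_components d d'. loop_scalar t mu K))"

definition tl_mult :: "pair_type \<Rightarrow> tl_elt \<Rightarrow> tl_elt \<Rightarrow> tl_elt" where
  "tl_mult t x y =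
     (\<Sum>a\<in>Poly_Mapping.keys x. \<Sum>b\<in>Poly_Mapping.keys y.
        Poly_Mapping.map ((*) (Poly_Mapping.lookup x a * Poly_Mapping.lookup y b))
          (basis_mult t a b))"

fun edge_elt :: "pair_type \<Rightarrow> edge \<Rightarrow> tl_elt" where
  "edge_elt t (lam, i, mu) = basis_elt (lam, gen_tangle (num_points t) i, mu)"

fun path_elt :: "pair_type \<Rightarrow> welt \<times> edge awalk \<Rightarrow> tl_elt" where
  "path_elt t (lam, []) = basis_elt (lam, id_tangle (num_points t), lam)"
| "path_elt t (lam, e # es) = foldl (tl_mult t) (edge_elt t e) (map (edge_elt t) es)"

end

theory Submission
  imports Defs
begin

text \<open>
  Give the scalar \<open>q\<close> the degree \<open>1\<close>. The theorem holds because right multiplication by the oriented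
  generators \<open>\<mu>e\<^sub>i\<nu>\<close> is then homogeneous: if \<open>(\<lambda>d\<mu>)(\<mu>e\<^sub>i\<nu>) = q\<^sup>a \<lambda>d'\<nu>\<close>, then the degree of \<open>\<lambda>d\<mu>\<close> plus
  the degree of the edge \<open>\<mu> \<rightarrow> \<nu>\<close> is the degree of \<open>\<lambda>d'\<nu>\<close> plus \<open>a\<close> (lemma \<open>glue_edge\<close>). Along a path \<open>T\<close> the
  product is therefore a monomial \<open>q\<^sup>a \<lambda>d\<mu>\<close> with \<open>deg(\<lambda>d\<mu>) + a = deg(T)\<close>
  (lemma \<open>foldl_edges_homogeneous\<close>), and an equation \<open>\<lambda>d\<mu> = e\<^sub>T\<close> forces \<open>a = 0\<close>.

  Homogeneity has a combinatorial and a Coxeter-theoretic half.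

  Stacking \<open>e\<^sub>i\<close> on \<open>d\<close> joins the northern vertices \<open>i\<close> and \<open>i+1\<close> of \<open>d\<close>. If they are the ends of one
  strand, a loop splits off; its label gives \<open>q\<^sup>\<plusminus>\<^sup>1\<close>, and this accounts exactly for the lost northern arc
  and for the southern arc of \<open>e\<^sub>i\<close>. Otherwise two strands, ending at \<open>x\<close> and \<open>y\<close>, merge into one. Planarity
  leaves few possible positions of \<open>x\<close> and \<open>y\<close>, and in each of them the degrees match provided the inner
  one of two nested strands is oriented (lemma \<open>strand_degree_join\<close>). A strand with other strands
  around it is not left-exposed, so it carries no bead; hence beads never enter the computation, and it
  suffices to carry along the invariant \<open>nested_oriented\<close>: the strands are non-crossing and every
  strand lying inside another one is oriented. This invariant survives the gluing
  (lemma \<open>nested_oriented_join\<close>).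

  The degree of an edge with label \<open>i\<close> is defined through the Bruhat order, and it has to be read off from
  the symbols at \<open>i\<close> and \<open>i+1\<close> (lemma \<open>edge_degree_symbols\<close>). For minimal representatives the length is, up
  to a constant, the sum of the positions of the symbols \<open>\<and>\<close>, counted from \<open>0\<close> (lemma \<open>min_reps_length\<close>),
  which changes by one in a direction visible from the diagram. That the symbols do change along an edge follows from
  the fact that a minimal representative is increasing on the points carrying equal symbols
  (lemma \<open>length_additive_increasing\<close>).
\<close>

section \<open>Words in the simple reflections\<close>

text \<open>Reflections stay folded, so that the laws for the coset diagram of \<open>w \<circ> simple_refl l\<close> apply.\<close>

declare simple_refl.simps [simp del]

lemma word_product_Nil [simp]: "word_product [] = id"
  by (simp add: word_product_def)

lemma word_product_Cons [simp]: "word_product (l # ls) = simple_refl l \<circ> word_product ls"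
  by (simp add: word_product_def)

lemma word_product_append [simp]:
  "word_product (ls @ ms) = word_product ls \<circ> word_product ms"
  by (induction ls) (simp_all add: comp_assoc)

lemma simple_refl_involution:
  assumes "l \<in> labels t"
  shows "simple_refl l \<circ> simple_refl l = id"
  using assms by (cases l; cases t) (auto simp: simple_refl.simps transpose_def fun_eq_iff)

lemma simple_refl_cancel:
  assumes "l \<in> labels t"
  shows "w \<circ> simple_refl l \<circ> simple_refl l = w"
  using simple_refl_involution[OF assms] by (simp add: comp_assoc)

lemma word_product_rev:
  assumes "set ls \<subseteq> labels t"
  shows "word_product ls \<circ> word_product (rev ls) = id"
  using assms
proof (induction ls)
  case (Cons l ls)
  have "word_product (l # ls) \<circ> word_product (rev (l # ls)) =
      simple_refl l \<circ> (word_product ls \<circ> word_product (rev ls)) \<circ> simple_refl l"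
    by (simp add: comp_assoc)
  also have "word_product ls \<circ> word_product (rev ls) = id"
    using Cons.prems by (intro Cons.IH) simp
  also have "simple_refl l \<circ> id \<circ> simple_refl l = id"
    using Cons.prems simple_refl_involution[of l t] by simp
  finally show "word_product (l # ls) \<circ> word_product (rev (l # ls)) = id" .
qed simp

lemma id_in_weyl_group: "id \<in> weyl_group t"
  unfolding weyl_group_def by (auto intro!: exI[of _ "[]"])

lemma weyl_group_snoc:
  assumes "w \<in> weyl_group t" "l \<in> labels t"
  shows "w \<circ> simple_refl l \<in> weyl_group t"
proof -
  obtain ls where "set ls \<subseteq> labels t" "w = word_product ls"
    using assms by (auto simp: weyl_group_def)
  then show ?thesis
    using assms(2) unfolding weyl_group_def by (auto intro!: exI[of _ "ls @ [l]"])
qed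

lemma weyl_group_comp:
  assumes "v \<in> weyl_group t" "w \<in> weyl_group t"
  shows "v \<circ> w \<in> weyl_group t"
proof -
  obtain ls ms where "set ls \<subseteq> labels t" "v = word_product ls"
    "set ms \<subseteq> labels t" "w = word_product ms"
    using assms by (auto simp: weyl_group_def)
  then show ?thesis
    unfolding weyl_group_def by (auto intro!: exI[of _ "ls @ ms"])
qed

lemma weyl_group_inverse:
  assumes "w \<in> weyl_group t"
  obtains v where "v \<in> weyl_group t" "v \<circ> w = id" "w \<circ> v = id"
proof -
  obtain ls where ls: "set ls \<subseteq> labels t" "w = word_product ls"
    using assms by (auto simp: weyl_group_def)
  have "word_product (rev ls) \<in> weyl_group t"
    using ls by (auto simp: weyl_group_def intro!: exI[of _ "rev ls"])
  moreover have "w \<circ> word_product (rev ls) = id" "word_product (rev ls) \<circ> w = id"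
    using word_product_rev[of ls t] word_product_rev[of "rev ls" t] ls by simp_all
  ultimately show ?thesis
    using that by blast
qed

lemma weyl_group_inj:
  assumes "w \<in> weyl_group t"
  shows "inj w"
  using weyl_group_inverse[OF assms] by (metis inj_on_id inj_on_imageI2)

lemma weyl_group_induct [consumes 1, case_names id snoc]:
  assumes "w \<in> weyl_group t"
    and "P id"
    and "\<And>w l. w \<in> weyl_group t \<Longrightarrow> P w \<Longrightarrow> l \<in> labels t \<Longrightarrow> P (w \<circ> simple_refl l)"
  shows "P w"
proof -
  obtain ls where ls: "set ls \<subseteq> labels t" and w: "w = word_product ls"
    using assms(1) by (auto simp: weyl_group_def)
  from ls have "P (word_product ls)"
  proof (induction ls rule: rev_induct)
    case Nil
    show "P (word_product [])"
      by (simp add: assms(2))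
  next
    case (snoc l ls)
    then have "P (word_product ls \<circ> simple_refl l)"
      by (intro assms(3)) (auto simp: weyl_group_def)
    then show "P (word_product (ls @ [l]))"
      by simp
  qed
  with w show ?thesis by simp
qed

lemma weyl_group_fixes_outside:
  assumes "w \<in> weyl_group t" "valid_pair t" "\<bar>x\<bar> > int (num_points t)"
  shows "w x = x"
  using assms
proof (induction arbitrary: x rule: weyl_group_induct)
  case (snoc w l)
  then have "simple_refl l x = x"
    by (cases l; cases t) (auto simp: simple_refl.simps transpose_def)
  with snoc show ?case by simp
qed simp

lemma weyl_group_pos_TypeA:
  assumes "w \<in> weyl_group t" "t = TypeA n k" "x > 0"
  shows "w x > 0"
  using assms
proof (induction arbitrary: x rule: weyl_group_induct)
  case (snoc w l)
  then have "simple_refl l x > 0"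
    by (cases l) (auto simp: simple_refl.simps transpose_def)
  with snoc show ?case by simp
qed simp

lemma weyl_group_one_TypeC:
  assumes "w \<in> weyl_group t" "t = TypeC n"
  shows "w 1 = 1"
  using assms
proof (induction rule: weyl_group_induct)
  case (snoc w l)
  then have "simple_refl l 1 = 1"
    by (cases l) (auto simp: simple_refl.simps transpose_def)
  with snoc show ?case by simp
qed simp

section \<open>The action of the simple reflections on coset diagrams\<close>

text \<open>
  Right multiplication by the reflection with label \<open>l\<close> affects the diagram only at the points
  \<open>label_pos l\<close> and \<open>label_pos l + 1\<close>, which are also the points joined by the arcs of the tangle of \<open>l\<close>.
\<close>
fun label_pos :: "slabel \<Rightarrow> nat" where
  "label_pos (Unprimed i) = i"
| "label_pos Primed = 1"
| "label_pos DPrimed = 1"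

lemma label_pos_bounds:
  assumes "valid_pair t" "l \<in> labels t"
  shows "1 \<le> label_pos l" "label_pos l < num_points t"
  using assms by (cases t; auto)+

lemma coset_diagram_snoc_off:
  assumes "w \<in> weyl_group t" "l \<in> labels t" "j \<ge> 1" "j \<noteq> label_pos l" "j \<noteq> label_pos l + 1"
  shows "coset_diagram t (w \<circ> simple_refl l) j = coset_diagram t w j"
  using assms
  by (cases l; cases t)
    (auto simp: coset_diagram_Unprimed coset_diagram_Primed coset_diagram_DPrimed)

lemma coset_diagram_eq_Circ_iff:
  assumes "w \<in> weyl_group t" "j \<ge> 1"
  shows "coset_diagram t w j = Circ \<longleftrightarrow> j = 1 \<and> (\<exists>n. t = TypeC n)"
  using assms
proof (induction arbitrary: j rule: weyl_group_induct)
  case id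
  then show "coset_diagram t id j = Circ \<longleftrightarrow> j = 1 \<and> (\<exists>n. t = TypeC n)"
    by (cases t) (auto simp: coset_diagram_id)
next
  case (snoc w l)
  have f: "flip s = Circ \<longleftrightarrow> s = Circ" for s
    by (cases s) auto
  show "coset_diagram t (w \<circ> simple_refl l) j = Circ \<longleftrightarrow> j = 1 \<and> (\<exists>n. t = TypeC n)"
    using snoc.IH[OF snoc.prems] snoc.IH[of 1] snoc.IH[of 2] snoc.IH[of "label_pos l"]
      snoc.IH[of "label_pos l + 1"] snoc.hyps snoc.prems
    by (cases l; cases t)
       (auto simp: coset_diagram_Unprimed coset_diagram_Primed coset_diagram_DPrimed f
             split: if_splits)
qed

text \<open>
  The symbol of a signed point in the empty diagram. The diagram of \<open>w\<close> is its pullback along \<open>w\<close>,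
  which allows evaluation at negative points and treats the three kinds of reflections alike.
\<close>
definition signed_symbol :: "pair_type \<Rightarrow> int \<Rightarrow> symbol" where
  "signed_symbol t x =
     (if x > 0 then empty_diagram t (nat x) else flip (empty_diagram t (nat (- x))))"

lemma coset_diagram_conv_signed: "coset_diagram t w j = signed_symbol t (w (int j))"
  by (simp add: coset_diagram_def signed_symbol_def Let_def)

lemma signed_symbol_uminus: "x \<noteq> 0 \<Longrightarrow> signed_symbol t (- x) = flip (signed_symbol t x)"
  by (auto simp: signed_symbol_def)

text \<open>
  A pair of signed points that the simple reflection exchanges, the smaller one first. It exchanges
  their negatives as well and fixes all other points.
\<close>
fun root_left :: "slabel \<Rightarrow> int" where
  "root_left (Unprimed i) = int i"
| "root_left Primed = -2"
| "root_left DPrimed = -2"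

fun root_right :: "slabel \<Rightarrow> int" where
  "root_right (Unprimed i) = int i + 1"
| "root_right Primed = 2"
| "root_right DPrimed = 1"

text \<open>
  For a label of the group, this says that \<open>w\<close> and \<open>w \<circ> simple_refl l\<close> have different diagrams.
\<close>
definition moves :: "pair_type \<Rightarrow> welt \<Rightarrow> slabel \<Rightarrow> bool" where
  "moves t w l \<longleftrightarrow> signed_symbol t (w (root_left l)) \<noteq> signed_symbol t (w (root_right l))"

lemma flip_eq_iff: "flip a = flip b \<longleftrightarrow> a = b"
  by (metis flip_flip)

lemma flip_Circ_iff: "flip a = Circ \<longleftrightarrow> a = Circ"
  by (cases a) auto

lemma moves_Unprimed:
  "moves t w (Unprimed i) \<longleftrightarrow> coset_diagram t w i \<noteq> coset_diagram t w (i + 1)"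
  by (simp add: moves_def coset_diagram_conv_signed add.commute)

lemma signed_symbol_at_negative:
  assumes "w \<in> weyl_group t" "j \<ge> 1"
  shows "signed_symbol t (w (- int j)) = flip (coset_diagram t w j)"
  using weyl_group_odd[OF assms(1), of "int j"] assms(2)
  by (simp add: coset_diagram_conv_signed signed_symbol_uminus)

lemma moves_Primed:
  assumes "w \<in> weyl_group t"
  shows "moves t w Primed"
  using signed_symbol_at_negative[OF assms, of 2] coset_diagram_eq_Circ_iff[OF assms, of 2]
  by (cases "coset_diagram t w 2") (auto simp: moves_def coset_diagram_conv_signed)

lemma moves_DPrimed:
  assumes "w \<in> weyl_group t" "t = TypeD n"
  shows "moves t w DPrimed \<longleftrightarrow> coset_diagram t w 1 = coset_diagram t w 2"
proof -
  have "coset_diagram t w 1 \<noteq> Circ" "coset_diagram t w 2 \<noteq> Circ"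
    using coset_diagram_eq_Circ_iff[OF assms(1)] assms(2) by auto
  moreover have "moves t w DPrimed \<longleftrightarrow> flip (coset_diagram t w 2) \<noteq> coset_diagram t w 1"
    using signed_symbol_at_negative[OF assms(1), of 2]
    by (auto simp: moves_def coset_diagram_conv_signed)
  ultimately show ?thesis
    by (cases "coset_diagram t w 1"; cases "coset_diagram t w 2") auto
qed

lemma sum_two_points:
  assumes "finite A" "a \<in> A" "b \<in> A" "a \<noteq> b"
  shows "sum f A = f a + (f b + sum f (A - {a, b}))"
proof -
  have "sum f A = f a + sum f (A - {a})"
    using assms by (simp add: sum.remove)
  also have "sum f (A - {a}) = f b + sum f (A - {a} - {b})"
    using assms by (intro sum.remove) auto
  also have "A - {a} - {b} = A - {a, b}" by auto
  finally show ?thesis .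
qed

section \<open>The height of a coset diagram\<close>

text \<open>
  Up to an additive constant this is the number of reflections needed to reach the diagram of \<open>w\<close>
  from the empty one. The weight \<open>j - 1\<close> serves all types: swaps of neighbours change it by one, the
  reflection \<open>1'\<close> acts at the point \<open>2\<close> of weight \<open>1\<close>, and \<open>1''\<close> at points whose weights add up to \<open>1\<close>.
\<close>
definition height :: "pair_type \<Rightarrow> welt \<Rightarrow> int" where
  "height t w = (\<Sum>j = 1..num_points t. if coset_diagram t w j = Up then int j - 1 else 0)"

lemma height_snoc:
  assumes w: "w \<in> weyl_group t" and t: "valid_pair t" and l: "l \<in> labels t"
  shows "height t (w \<circ> simple_refl l) =
    height t w + (if \<not> moves t w l then 0
                  else if coset_diagram t w (label_pos l + 1) = Down then 1 else -1)"
proof -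
  let ?j = "label_pos l" and ?f = "\<lambda>w j. if coset_diagram t w j = Up then int j - 1 else 0"
  note b = label_pos_bounds[OF t l]
  have split: "height t v = ?f v ?j + (?f v (?j + 1) + (\<Sum>j\<in>{1..num_points t} - {?j, ?j + 1}. ?f v j))"
    for v
    unfolding height_def using b by (intro sum_two_points) auto
  have rest: "(\<Sum>j\<in>{1..num_points t} - {?j, ?j + 1}. ?f (w \<circ> simple_refl l) j) =
      (\<Sum>j\<in>{1..num_points t} - {?j, ?j + 1}. ?f w j)"
    by (intro sum.cong refl) (auto simp: coset_diagram_snoc_off[OF w l])
  note circ = coset_diagram_eq_Circ_iff[OF w]
  show ?thesis
  proof (cases l)
    case (Unprimed i)
    then have "i \<ge> 1" "coset_diagram t w i \<noteq> Circ" "coset_diagram t w (i + 1) \<noteq> Circ"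
      using l circ[of i] circ[of "i + 1"] b by (cases t; auto)+
    then show ?thesis
      unfolding split[of w] split[of "w \<circ> simple_refl l"] rest unfolding Unprimed
      by (cases "coset_diagram t w i"; cases "coset_diagram t w (i + 1)")
         (auto simp: moves_Unprimed coset_diagram_Unprimed)
  next
    case Primed
    then have "coset_diagram t w 1 = Circ" "coset_diagram t w 2 \<noteq> Circ"
      using l circ[of 1] circ[of 2] by (cases t; auto)+
    then show ?thesis
      unfolding split[of w] split[of "w \<circ> simple_refl l"] rest unfolding Primed
      using w
      by (cases "coset_diagram t w 2")
         (auto simp: moves_Primed coset_diagram_Primed numeral_2_eq_2[symmetric])
  next
    case DPrimed
    then obtain n where "t = TypeD n" "coset_diagram t w 1 \<noteq> Circ" "coset_diagram t w 2 \<noteq> Circ"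
      using l circ[of 1] circ[of 2] by (cases t; auto)+
    then show ?thesis
      unfolding split[of w] split[of "w \<circ> simple_refl l"] rest unfolding DPrimed
      using w
      by (cases "coset_diagram t w 1"; cases "coset_diagram t w 2")
         (auto simp: moves_DPrimed coset_diagram_DPrimed numeral_2_eq_2[symmetric])
  qed
qed

lemma coset_diagram_snoc_right:
  assumes w: "w \<in> weyl_group t" and t: "valid_pair t" and l: "l \<in> labels t" and m: "moves t w l"
  shows "coset_diagram t (w \<circ> simple_refl l) (label_pos l + 1) =
         flip (coset_diagram t w (label_pos l + 1))"
proof (cases l)
  case (Unprimed i)
  then have "i \<ge> 1" "coset_diagram t w i \<noteq> Circ" "coset_diagram t w (i + 1) \<noteq> Circ"
    using l coset_diagram_eq_Circ_iff[OF w, of i] coset_diagram_eq_Circ_iff[OF w, of "i + 1"]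
    by (cases t; auto)+
  then show ?thesis
    using m unfolding Unprimed
    by (cases "coset_diagram t w i"; cases "coset_diagram t w (i + 1)")
       (auto simp: moves_Unprimed coset_diagram_Unprimed)
next
  case Primed
  then show ?thesis
    using w by (simp add: coset_diagram_Primed numeral_2_eq_2[symmetric])
next
  case DPrimed
  then obtain n where "t = TypeD n"
    using l by (cases t) auto
  then show ?thesis
    using w m unfolding DPrimed
    by (simp add: coset_diagram_DPrimed moves_DPrimed numeral_2_eq_2[symmetric])
qed

text \<open>
  The invariant of the diagrams that separates the empty one from the others in which no reflection
  lowers the height: the number of symbols \<open>\<and>\<close> is constant in type A, and even in type D.
\<close>
definition num_ups :: "pair_type \<Rightarrow> welt \<Rightarrow> nat" where
  "num_ups t w = card {j \<in> {1..num_points t}. coset_diagram t w j = Up}"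

lemma num_ups_conv_sum:
  "num_ups t w = (\<Sum>j = 1..num_points t. of_bool (coset_diagram t w j = Up))"
  unfolding num_ups_def by (simp add: of_bool_def sum.If_cases Int_def conj_commute)

lemma num_ups_snoc:
  assumes w: "w \<in> weyl_group t" and t: "valid_pair t" and l: "l \<in> labels t"
  shows "num_ups t (w \<circ> simple_refl l) + of_bool (coset_diagram t w (label_pos l) = Up)
           + of_bool (coset_diagram t w (label_pos l + 1) = Up) =
         num_ups t w + of_bool (coset_diagram t (w \<circ> simple_refl l) (label_pos l) = Up)
           + of_bool (coset_diagram t (w \<circ> simple_refl l) (label_pos l + 1) = Up)"
proof -
  let ?j = "label_pos l" and ?f = "\<lambda>w j. of_bool (coset_diagram t w j = Up) :: nat"
  have split: "num_ups t v = ?f v ?j + (?f v (?j + 1) + (\<Sum>j\<in>{1..num_points t} - {?j, ?j + 1}. ?f v j))"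
    for v
    unfolding num_ups_conv_sum using label_pos_bounds[OF t l] by (intro sum_two_points) auto
  have "(\<Sum>j\<in>{1..num_points t} - {?j, ?j + 1}. ?f (w \<circ> simple_refl l) j) =
      (\<Sum>j\<in>{1..num_points t} - {?j, ?j + 1}. ?f w j)"
    by (intro sum.cong refl) (auto simp: coset_diagram_snoc_off[OF w l])
  then show ?thesis
    unfolding split[of w] split[of "w \<circ> simple_refl l"] by linarith
qed

lemma num_ups_TypeA:
  assumes "w \<in> weyl_group t" "t = TypeA n k" "valid_pair t"
  shows "num_ups t w = k"
  using assms
proof (induction rule: weyl_group_induct)
  case id
  have "{j \<in> {1..n + 1}. j \<le> k} = {1..k}"
    using id by auto
  then have "card {j \<in> {1..n + 1}. j \<le> k} = k"
    by simp
  moreover have "{j \<in> {1..num_points t}. coset_diagram t id j = Up} = {j \<in> {1..n + 1}. j \<le> k}"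
    using id by (auto simp: coset_diagram_id split: if_splits)
  ultimately show "num_ups t id = k"
    by (simp only: num_ups_def)
next
  case (snoc w l)
  then obtain i where "l = Unprimed i" "i \<ge> 1" by auto
  then have "num_ups t (w \<circ> simple_refl l) = num_ups t w"
    using snoc.prems num_ups_snoc[OF snoc.hyps(1) _ snoc.hyps(2)]
    by (simp add: coset_diagram_Unprimed)
  then show "num_ups t (w \<circ> simple_refl l) = k"
    using snoc by simp
qed

lemma num_ups_TypeD:
  assumes "w \<in> weyl_group t" "t = TypeD n" "valid_pair t"
  shows "even (num_ups t w)"
  using assms
proof (induction rule: weyl_group_induct)
  case id
  have "{j \<in> {1..num_points t}. coset_diagram t id j = Up} = {}"
    using id by (auto simp: coset_diagram_id)
  then show "even (num_ups t id)"
    by (simp only: num_ups_def) simp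
next
  case (snoc w l)
  have circ: "coset_diagram t w 1 \<noteq> Circ" "coset_diagram t w 2 \<noteq> Circ"
    using coset_diagram_eq_Circ_iff[OF snoc.hyps(1)] snoc.prems by auto
  have "even (num_ups t (w \<circ> simple_refl l)) \<longleftrightarrow> even (num_ups t w)"
  proof (cases l)
    case (Unprimed i)
    then have "i \<ge> 1" using snoc by auto
    then show ?thesis
      using snoc.prems num_ups_snoc[OF snoc.hyps(1) _ snoc.hyps(2)] Unprimed
      by (simp add: coset_diagram_Unprimed)
  next
    case Primed
    then show ?thesis using snoc by auto
  next
    case DPrimed
    then show ?thesis
      using snoc.prems arg_cong[where f = even, OF num_ups_snoc[OF snoc.hyps(1) snoc.prems(2) snoc.hyps(2)]]
        circ snoc.hyps(1)
      by (cases "coset_diagram t w 1"; cases "coset_diagram t w 2")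
         (auto simp: coset_diagram_DPrimed numeral_2_eq_2[symmetric])
  qed
  then show "even (num_ups t (w \<circ> simple_refl l))"
    using snoc by simp
qed

text \<open>
  Without a \<open>\<or>\<close> immediately to the left of a \<open>\<and>\<close>, all symbols \<open>\<and>\<close> stand in front of all symbols \<open>\<or>\<close>. In type A
  their number then fixes the diagram. In type C the reflection \<open>1'\<close> rules out a \<open>\<and>\<close> at the first
  point after \<open>\<circ>\<close>. In type D the reflection \<open>1''\<close> rules out two of them, and parity the remaining single one.
\<close>
lemma no_descent_imp_empty_diagram:
  assumes w: "w \<in> weyl_group t" and t: "valid_pair t"
    and nd: "\<And>l. l \<in> labels t \<Longrightarrow> moves t w l \<Longrightarrow> coset_diagram t w (label_pos l + 1) \<noteq> Up"
    and j: "1 \<le> j" "j \<le> num_points t"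
  shows "coset_diagram t w j = empty_diagram t j"
proof -
  note circ = coset_diagram_eq_Circ_iff[OF w]
  let ?U = "{j \<in> {1..num_points t}. coset_diagram t w j = Up}"
  have step: "coset_diagram t w i = Up"
    if "Unprimed i \<in> labels t" "coset_diagram t w (i + 1) = Up" for i
    using nd[OF that(1)] that(2) by (auto simp: moves_Unprimed)
  show ?thesis
  proof (cases t)
    case (TypeA n k)
    have down: "coset_diagram t w i = Up" if "i \<le> m" "1 \<le> i" "m \<le> n + 1" "coset_diagram t w m = Up" for i m
      using that
    proof (induction rule: inc_induct)
      case (step i)
      then show ?case using TypeA \<open>\<And>i. _ \<Longrightarrow> _ \<Longrightarrow> coset_diagram t w i = Up\<close>[of i] by auto
    qed
    have card: "card ?U = k"
      using num_ups_TypeA[OF w TypeA t] by (simp add: num_ups_def)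
    have "coset_diagram t w j = Up \<longleftrightarrow> j \<le> k"
    proof
      assume "coset_diagram t w j = Up"
      then have "{1..j} \<subseteq> ?U"
        using down[of _ j] j TypeA by auto
      then have "card {1..j} \<le> card ?U"
        by (intro card_mono) auto
      then show "j \<le> k" using card by simp
    next
      assume "j \<le> k"
      show "coset_diagram t w j = Up"
      proof (rule ccontr)
        assume "coset_diagram t w j \<noteq> Up"
        then have "\<not> j \<le> m" if "m \<in> ?U" for m
          using down[of j m] j TypeA that by auto
        then have "?U \<subseteq> {1..<j}"
          by (force simp: not_le)
        then have "card ?U \<le> card {1..<j}"
          by (intro card_mono) auto
        then show False using card \<open>j \<le> k\<close> j by simp
      qed
    qed
    then show ?thesis
      using circ[of j] j TypeA by (cases "coset_diagram t w j") auto
  next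
    case (TypeC n)
    have "coset_diagram t w i \<noteq> Up" if "2 \<le> i" "i \<le> n + 1" for i
      using that
    proof (induction rule: dec_induct)
      case base
      then show ?case
        using nd[of Primed] moves_Primed[OF w] TypeC by (simp add: numeral_2_eq_2)
    next
      case (step i)
      then show ?case using \<open>\<And>i. _ \<Longrightarrow> _ \<Longrightarrow> coset_diagram t w i = Up\<close>[of i] TypeC by auto
    qed
    then show ?thesis
      using circ[of j] j TypeC by (cases "coset_diagram t w j"; cases "j = 1") auto
  next
    case (TypeD n)
    have ne: "coset_diagram t w i \<noteq> Up" if "2 \<le> i" "i \<le> n" for i
      using that
    proof (induction rule: dec_induct)
      case base
      show ?case
      proof
        assume u: "coset_diagram t w 2 = Up"
        then have "coset_diagram t w 1 = Up"
          using step[of 1] TypeD t by (simp add: numeral_2_eq_2)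
        then show False
          using u nd[of DPrimed] moves_DPrimed[OF w TypeD] TypeD by (simp add: numeral_2_eq_2)
      qed
    next
      case (step i)
      then show ?case using \<open>\<And>i. _ \<Longrightarrow> _ \<Longrightarrow> coset_diagram t w i = Up\<close>[of i] TypeD by auto
    qed
    have "coset_diagram t w 1 \<noteq> Up"
    proof
      assume "coset_diagram t w 1 = Up"
      then have "?U = {1}"
        using ne TypeD t by (auto simp: le_Suc_eq) (metis One_nat_def Suc_1 Suc_leI le_neq_implies_less)
      then have "num_ups t w = 1"
        by (simp add: num_ups_def)
      then show False
        using num_ups_TypeD[OF w TypeD t] by simp
    qed
    then show ?thesis
      using ne[of j] circ[of j] j TypeD by (cases "coset_diagram t w j"; cases "j = 1") auto
  qed
qed

lemma coset_diagram_outside: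
  assumes "w \<in> weyl_group t" "valid_pair t" "j > num_points t"
  shows "coset_diagram t w j = empty_diagram t j"
  using weyl_group_fixes_outside[OF assms(1,2), of "int j"] assms(3)
  by (simp add: coset_diagram_def)

section \<open>Lengths of minimal coset representatives\<close>
lemma coxeter_length_le:
  assumes "set ls \<subseteq> labels t"
  shows "coxeter_length t (word_product ls) \<le> length ls"
  unfolding coxeter_length_def using assms by (intro Least_le) auto

lemma reduced_word:
  assumes "w \<in> weyl_group t"
  obtains ls where "set ls \<subseteq> labels t" "word_product ls = w" "length ls = coxeter_length t w"
proof -
  have "\<exists>l. \<exists>ls. set ls \<subseteq> labels t \<and> word_product ls = w \<and> length ls = l"
    using assms by (auto simp: weyl_group_def)
  from LeastI_ex[OF this] show ?thesis
    using that unfolding coxeter_length_def by blast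
qed

lemma word_product_in_weyl_group: "set ls \<subseteq> labels t \<Longrightarrow> word_product ls \<in> weyl_group t"
  by (auto simp: weyl_group_def)

lemma height_word_product_le:
  assumes "valid_pair t" "set ls \<subseteq> labels t"
  shows "height t (word_product ls) \<le> height t id + int (length ls)"
  using assms(2)
proof (induction ls rule: rev_induct)
  case (snoc l ls)
  then have IH: "height t (word_product ls) \<le> height t id + int (length ls)"
    by (intro snoc.IH) simp
  have "height t (word_product ls \<circ> simple_refl l) \<le> height t (word_product ls) + 1"
    using snoc.prems height_snoc[of "word_product ls" t l] assms(1)
    by (auto simp: word_product_in_weyl_group)
  also note IH
  finally show "height t (word_product (ls @ [l])) \<le> height t id + int (length (ls @ [l]))"
    by simp
qed simp

lemma coset_diagram_snoc_cong:
  assumes "v \<in> weyl_group t" "w \<in> weyl_group t" "l \<in> labels t"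
    and eq: "\<And>j. j \<ge> 1 \<Longrightarrow> coset_diagram t v j = coset_diagram t w j"
    and j: "j \<ge> 1"
  shows "coset_diagram t (v \<circ> simple_refl l) j = coset_diagram t (w \<circ> simple_refl l) j"
proof (cases l)
  case (Unprimed i)
  then have "i \<ge> 1" using assms(3) by (cases t) auto
  then show ?thesis
    using j eq by (simp add: Unprimed coset_diagram_Unprimed)
qed (use assms in \<open>simp_all add: coset_diagram_Primed coset_diagram_DPrimed\<close>)

text \<open>
  Walking down from the diagram of \<open>w\<close>, the height drops by one in every step, and the only diagram
  at which the walk can stop is the empty one.
\<close>
lemma ex_word_with_coset_diagram:
  assumes t: "valid_pair t" and w: "w \<in> weyl_group t"
  obtains ls where "set ls \<subseteq> labels t"
    "\<And>j. j \<ge> 1 \<Longrightarrow> coset_diagram t (word_product ls) j = coset_diagram t w j"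
    "int (length ls) = height t w - height t id"
proof -
  have nonneg: "height t v \<ge> 0" for v
    unfolding height_def by (intro sum_nonneg) auto
  have "\<exists>ls. set ls \<subseteq> labels t \<and>
      (\<forall>j\<ge>1. coset_diagram t (word_product ls) j = coset_diagram t w j) \<and>
      int (length ls) = height t w - height t id"
    using w
  proof (induction "nat (height t w)" arbitrary: w rule: less_induct)
    case less
    show ?case
    proof (cases "\<exists>l\<in>labels t. moves t w l \<and> coset_diagram t w (label_pos l + 1) = Up")
      case False
      then have eq: "coset_diagram t w j = coset_diagram t id j" if "j \<ge> 1" for j
        using no_descent_imp_empty_diagram[OF less.prems t, of j] that
          coset_diagram_outside[OF less.prems t, of j]
        by (cases "j \<le> num_points t") (auto simp: coset_diagram_id)
      then have "height t w = height t id"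
        unfolding height_def by (intro sum.cong) auto
      with eq show ?thesis
        by (intro exI[of _ "[]"]) auto
    next
      case True
      then obtain l where l: "l \<in> labels t" "moves t w l"
        "coset_diagram t w (label_pos l + 1) = Up" by blast
      have W: "w \<circ> simple_refl l \<in> weyl_group t"
        using less.prems l by (intro weyl_group_snoc)
      have h: "height t (w \<circ> simple_refl l) = height t w - 1"
        using height_snoc[OF less.prems t l(1)] l by simp
      with nonneg[of "w \<circ> simple_refl l"] have "nat (height t (w \<circ> simple_refl l)) < nat (height t w)"
        by linarith
      from less.hyps[OF this W] obtain ls where ls: "set ls \<subseteq> labels t"
        "\<And>j. j \<ge> 1 \<Longrightarrow> coset_diagram t (word_product ls) j = coset_diagram t (w \<circ> simple_refl l) j"
        "int (length ls) = height t (w \<circ> simple_refl l) - height t id"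
        by blast
      have "coset_diagram t (word_product (ls @ [l])) j = coset_diagram t w j" if "j \<ge> 1" for j
        using coset_diagram_snoc_cong[OF word_product_in_weyl_group[OF ls(1)] W l(1) ls(2) that]
        by (simp add: simple_refl_cancel[OF l(1)])
      then show ?thesis
        using ls l h by (intro exI[of _ "ls @ [l]"]) auto
    qed
  qed
  then show ?thesis using that by blast
qed

section \<open>The stabiliser of the empty diagram\<close>
lemma increasing_self_map_eq_id:
  fixes f :: "nat \<Rightarrow> nat"
  assumes inc: "\<And>j. 1 \<le> j \<Longrightarrow> j < N \<Longrightarrow> f j < f (j + 1)"
    and pos: "\<And>j. 1 \<le> j \<Longrightarrow> j \<le> N \<Longrightarrow> 1 \<le> f j \<and> f j \<le> N"
    and j: "1 \<le> j" "j \<le> N"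
  shows "f j = j"
proof (rule antisym)
  show "j \<le> f j"
    using j
  proof (induction rule: dec_induct)
    case base
    then show ?case using pos[of 1] j by simp
  next
    case (step i)
    then show ?case using inc[of i] by simp
  qed
  show "f j \<le> j"
    using j(2,1)
  proof (induction rule: inc_induct)
    case base
    then show ?case using pos[of N] by simp
  next
    case (step i)
    then show ?case using inc[of i] by simp
  qed
qed

lemma parabolic_snoc:
  assumes "w \<in> parabolic t" "l \<in> labels t" "l \<noteq> crossed_label t"
  shows "w \<circ> simple_refl l \<in> parabolic t"
proof -
  obtain ls where "set ls \<subseteq> labels t - {crossed_label t}" "w = word_product ls"
    using assms by (auto simp: parabolic_def)
  then show ?thesis
    using assms(2,3) unfolding parabolic_def by (auto intro!: exI[of _ "ls @ [l]"])
qed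

lemma stabiliser_point_range:
  assumes w: "w \<in> weyl_group t" and t: "valid_pair t"
    and E: "\<And>j. 1 \<le> j \<Longrightarrow> coset_diagram t w j = empty_diagram t j"
    and j: "1 \<le> j" "j \<le> num_points t"
  shows "1 \<le> w (int j)" "w (int j) \<le> int (num_points t)"
proof -
  have nz: "w (int j) \<noteq> 0"
    using weyl_group_odd(2)[OF w] j by auto
  have "\<not> w (int j) < 0"
  proof
    assume neg: "w (int j) < 0"
    then have flipped: "flip (empty_diagram t (nat (- w (int j)))) = empty_diagram t j"
      using E[of j] j by (simp add: coset_diagram_def Let_def split: if_splits)
    show False
    proof (cases t)
      case (TypeA n k)
      then show False using weyl_group_pos_TypeA[OF w TypeA, of "int j"] neg j by simp
    next
      case (TypeC n)
      have "j \<noteq> 1"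
        using weyl_group_one_TypeC[OF w TypeC] neg by auto
      then show False using flipped TypeC by (auto split: if_splits)
    next
      case (TypeD n)
      then show False using flipped by simp
    qed
  qed
  with nz show "1 \<le> w (int j)" by simp
  show "w (int j) \<le> int (num_points t)"
  proof (rule ccontr)
    assume a: "\<not> w (int j) \<le> int (num_points t)"
    then have "w (w (int j)) = w (int j)"
      using weyl_group_fixes_outside[OF w t, of "w (int j)"] by simp
    then have "w (int j) = int j"
      using weyl_group_inj[OF w] by (simp add: inj_eq)
    then show False using a j by simp
  qed
qed

text \<open>
  Sorting: as long as \<open>w\<close> has a descent at a reflection of the parabolic subgroup, multiplication by that
  reflection decreases the sum of the \<open>j \<cdot> (N - w j)\<close>, which is nonnegative. Once there are no such
  descents, \<open>w\<close> is increasing on all points: in type A it cannot descend at the crossed node because it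
  preserves the symbols, and in type C it fixes the point \<open>1\<close>. An increasing permutation is the identity.
\<close>
lemma stabiliser_subset_parabolic:
  assumes w: "w \<in> weyl_group t" and t: "valid_pair t"
    and E: "\<And>j. 1 \<le> j \<Longrightarrow> coset_diagram t w j = empty_diagram t j"
  shows "w \<in> parabolic t"
  using w E
proof (induction "nat (\<Sum>j = 1..num_points t. int j * (int (num_points t) - w (int j)))"
    arbitrary: w rule: less_induct)
  case less
  note W = less.prems(1) and E = less.prems(2)
  let ?N = "num_points t"
  have range: "1 \<le> w (int j)" "w (int j) \<le> int ?N" if "1 \<le> j" "j \<le> ?N" for j
    using E that by (auto intro: stabiliser_point_range[OF W t])
  show ?case
  proof (cases "\<exists>i. Unprimed i \<in> labels t - {crossed_label t} \<and> w (int i) > w (int (i + 1))")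
    case True
    then obtain i where l: "Unprimed i \<in> labels t" "Unprimed i \<noteq> crossed_label t"
      and desc: "w (int i) > w (int (i + 1))" by blast
    let ?v = "w \<circ> simple_refl (Unprimed i)"
    have i: "1 \<le> i" "i + 1 \<le> ?N"
      using label_pos_bounds[OF t l(1)] by simp_all
    have V: "?v \<in> weyl_group t"
      using W l(1) by (rule weyl_group_snoc)
    \<comment> \<open>The empty diagram changes its symbol only at the crossed node.\<close>
    have same: "empty_diagram t i = empty_diagram t (i + 1)"
      using l by (cases t) auto
    have EV: "coset_diagram t ?v j = empty_diagram t j" if "1 \<le> j" for j
      using E[of j] E[of i] E[of "i + 1"] that i same by (simp add: coset_diagram_Unprimed)
    let ?g = "\<lambda>v j. int j * (int ?N - v (int j))"
    have split: "(\<Sum>j = 1..?N. ?g v j) =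
        ?g v i + (?g v (i + 1) + (\<Sum>j\<in>{1..?N} - {i, i + 1}. ?g v j))" for v
      using i by (intro sum_two_points) auto
    have rest: "(\<Sum>j\<in>{1..?N} - {i, i + 1}. ?g ?v j) = (\<Sum>j\<in>{1..?N} - {i, i + 1}. ?g w j)"
      by (intro sum.cong refl) (auto simp: simple_refl.simps transpose_def)
    have "?v (int i) = w (int (i + 1))" "?v (int (i + 1)) = w (int i)"
      using i by (auto simp: simple_refl.simps transpose_def add.commute)
    then have "(\<Sum>j = 1..?N. ?g ?v j) = (\<Sum>j = 1..?N. ?g w j) - (w (int i) - w (int (i + 1)))"
      unfolding split[of w] split[of ?v] rest by (simp add: algebra_simps)
    moreover have "(\<Sum>j = 1..?N. ?g ?v j) \<ge> 0"
      using stabiliser_point_range(2)[OF V t EV] by (intro sum_nonneg mult_nonneg_nonneg) auto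
    ultimately have "nat (\<Sum>j = 1..?N. ?g ?v j) < nat (\<Sum>j = 1..?N. ?g w j)"
      using desc by linarith
    from less.hyps[OF this V EV] have "?v \<in> parabolic t"
      by simp
    then have "?v \<circ> simple_refl (Unprimed i) \<in> parabolic t"
      using l by (rule parabolic_snoc)
    moreover have "?v \<circ> simple_refl (Unprimed i) = w"
      using l(1) by (rule simple_refl_cancel)
    ultimately show ?thesis
      by metis
  next
    case False
    have inc: "w (int j) < w (int (j + 1))" if j: "1 \<le> j" "j < ?N" for j
    proof (cases "Unprimed j \<in> labels t - {crossed_label t}")
      case True
      then have "w (int j) \<le> w (int (j + 1))"
        using False by (meson not_le)
      moreover have "w (int j) \<noteq> w (int (j + 1))"
        using weyl_group_inj[OF W] by (simp add: inj_eq)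
      ultimately show ?thesis by simp
    next
      case nl: False
      show ?thesis
      proof (cases t)
        case (TypeA n k)
        with nl j have [simp]: "j = k" by auto
        have "coset_diagram t w k = Up" "coset_diagram t w (k + 1) = Down"
          using E[of k] E[of "k + 1"] j TypeA by simp_all
        then have "w (int k) \<le> int k" "int k < w (int (k + 1))"
          using range[of k] range[of "k + 1"] j TypeA
          by (auto simp: coset_diagram_def Let_def split: if_splits)
        then show ?thesis by simp
      next
        case (TypeC n)
        with nl j have [simp]: "j = 1" by auto
        have "w 1 = 1" using weyl_group_one_TypeC[OF W TypeC] .
        moreover have "w 2 \<noteq> w 1"
          using weyl_group_inj[OF W] by (simp add: inj_eq)
        ultimately show ?thesis
          using range[of 2] j by simp
      next
        case (TypeD n)
        then show ?thesis using nl j by auto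
      qed
    qed
    have fixed: "w (int j) = int j" if j: "1 \<le> j" "j \<le> ?N" for j
    proof -
      have "nat (w (int j)) = j"
      proof (rule increasing_self_map_eq_id[where N = ?N, OF _ _ j])
        show "nat (w (int i)) < nat (w (int (i + 1)))" if "1 \<le> i" "i < ?N" for i
          using inc[OF that] range(1)[of i] that by linarith
        show "1 \<le> nat (w (int i)) \<and> nat (w (int i)) \<le> ?N" if "1 \<le> i" "i \<le> ?N" for i
          using range[OF that] by linarith
      qed
      then show ?thesis using range[OF j] by simp
    qed
    have "w x = x" for x
    proof (cases "\<bar>x\<bar> > int ?N \<or> x = 0")
      case True
      then show ?thesis
        using weyl_group_odd[OF W, of x] weyl_group_fixes_outside[OF W t, of x] by auto
    next
      case False
      then have "w (int (nat \<bar>x\<bar>)) = int (nat \<bar>x\<bar>)"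
        by (intro fixed) auto
      then show ?thesis
        using weyl_group_odd(1)[OF W, of x] by (cases "x > 0") auto
    qed
    then have "w = id" by auto
    then show ?thesis
      unfolding parabolic_def by (auto intro!: exI[of _ "[]"])
  qed
qed

section \<open>Minimal representatives and the Bruhat order\<close>
lemma coxeter_length_ge_height:
  assumes "valid_pair t" "w \<in> weyl_group t"
  shows "height t w - height t id \<le> int (coxeter_length t w)"
  using reduced_word[OF assms(2)] height_word_product_le[OF assms(1)]
  by (metis diff_le_eq add.commute)

text \<open>
  The word produced by \<open>ex_word_with_coset_diagram\<close> has the same diagram as \<open>w\<close>, hence differs from \<open>w\<close>
  by an element of the stabiliser of the empty diagram, that is, of \<open>P\<close>. Minimality of \<open>w\<close> bounds its
  length by that of the word, and no word can be shorter since each letter changes the height by at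
  most one.
\<close>
lemma min_reps_length:
  assumes t: "valid_pair t" and w: "w \<in> min_reps t"
  shows "int (coxeter_length t w) = height t w - height t id"
proof (rule antisym)
  have W: "w \<in> weyl_group t"
    using w by (simp add: min_reps_def)
  show "height t w - height t id \<le> int (coxeter_length t w)"
    using t W by (rule coxeter_length_ge_height)
  obtain ls where ls: "set ls \<subseteq> labels t"
    "\<And>j. j \<ge> 1 \<Longrightarrow> coset_diagram t (word_product ls) j = coset_diagram t w j"
    "int (length ls) = height t w - height t id"
    using ex_word_with_coset_diagram[OF t W] by blast
  let ?v = "word_product ls"
  have V: "?v \<in> weyl_group t"
    using ls(1) by (rule word_product_in_weyl_group)
  obtain u where u: "u \<in> weyl_group t" "u \<circ> w = id" "w \<circ> u = id"
    using weyl_group_inverse[OF W] by blast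
  have "coset_diagram t (?v \<circ> u) j = empty_diagram t j" if j: "1 \<le> j" for j
  proof -
    have signed: "signed_symbol t (?v x) = signed_symbol t (w x)" if "x \<noteq> 0" for x
    proof (cases "x > 0")
      case True
      then show ?thesis
        using ls(2)[of "nat x"] by (simp add: coset_diagram_conv_signed)
    next
      case False
      then have x: "x = - int (nat (- x))" "nat (- x) \<ge> 1" using that by auto
      then show ?thesis
        using signed_symbol_at_negative[OF V x(2)] signed_symbol_at_negative[OF W x(2)]
          ls(2)[OF x(2)] by simp
    qed
    have "u (int j) \<noteq> 0"
      using weyl_group_odd(2)[OF u(1)] j by auto
    then have "coset_diagram t (?v \<circ> u) j = signed_symbol t ((w \<circ> u) (int j))"
      by (simp add: coset_diagram_conv_signed signed)
    also have "\<dots> = empty_diagram t j"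
      using j by (simp add: u(3) signed_symbol_def)
    finally show ?thesis .
  qed
  then have "?v \<circ> u \<in> parabolic t"
    using weyl_group_comp[OF V u(1)] t by (intro stabiliser_subset_parabolic) auto
  then have "coxeter_length t w \<le> coxeter_length t (?v \<circ> u \<circ> w)"
    using w by (auto simp: min_reps_def)
  also have "?v \<circ> u \<circ> w = ?v"
    using u(2) by (simp add: comp_assoc)
  also have "coxeter_length t ?v \<le> length ls"
    using ls(1) by (rule coxeter_length_le)
  finally show "int (coxeter_length t w) \<le> height t w - height t id"
    using ls(3) by simp
qed

lemma simple_refl_inversions:
  assumes l: "l \<in> labels t" and nz: "x \<noteq> 0" "y \<noteq> 0"
    and inv: "x < y" "\<not> simple_refl l x < simple_refl l y"
  shows "(case l of
      Unprimed i \<Rightarrow> i \<ge> 1 \<and> (x = int i \<and> y = int i + 1 \<or> x = - int i - 1 \<and> y = - int i)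
    | Primed \<Rightarrow> (\<exists>n. t = TypeC n) \<and> (x = -2 \<and> (y = -1 \<or> y = 1 \<or> y = 2) \<or> y = 2 \<and> (x = -1 \<or> x = 1))
    | DPrimed \<Rightarrow> (\<exists>n. t = TypeD n) \<and> (x = -2 \<or> x = -1) \<and> (y = 1 \<or> y = 2))"
proof (cases l)
  case (Unprimed i)
  have i: "i \<ge> 1" using l Unprimed by (cases t) auto
  have v: "simple_refl l z = (if z = int i then int i + 1 else if z = int i + 1 then int i
      else if z = - int i then - int i - 1 else if z = - int i - 1 then - int i else z)" for z
    using i Unprimed by (auto simp: simple_refl.simps transpose_def)
  have "x = int i \<and> y = int i + 1 \<or> x = - int i - 1 \<and> y = - int i"
    using inv i unfolding v[of x] v[of y] by (simp split: if_splits)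
  with i Unprimed show ?thesis by simp
next
  case Primed
  have "simple_refl l z = (if z = 2 then -2 else if z = -2 then 2 else z)" for z
    using Primed by (auto simp: simple_refl.simps transpose_def)
  with inv nz have "x = -2 \<and> (y = -1 \<or> y = 1 \<or> y = 2) \<or> y = 2 \<and> (x = -1 \<or> x = 1)"
    by (smt (verit))
  with l Primed show ?thesis by (cases t) auto
next
  case DPrimed
  have "simple_refl l z = (if z = 1 then -2 else if z = -2 then 1 else if z = 2 then -1
      else if z = -1 then 2 else z)" for z
    using DPrimed by (auto simp: simple_refl.simps transpose_def)
  with inv nz have "(x = -2 \<or> x = -1) \<and> (y = 1 \<or> y = 2)"
    by (smt (verit))
  with l DPrimed show ?thesis by (cases t) auto
qed

text \<open>
  A simple reflection reverses the order of few pairs of signed points. If it moves the diagram, the two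
  symbols in each of these pairs are different.
\<close>
lemma simple_refl_monotone:
  assumes l: "l \<in> labels t" and w: "w \<in> weyl_group t"
    and nz: "x \<noteq> 0" "y \<noteq> 0" and xy: "x < y" and m: "moves t w l"
    and same: "signed_symbol t (w (simple_refl l x)) = signed_symbol t (w (simple_refl l y))"
  shows "simple_refl l x < simple_refl l y"
proof (rule ccontr)
  assume "\<not> ?thesis"
  note inv = simple_refl_inversions[OF l nz xy this]
  let ?S = "\<lambda>z. signed_symbol t (w z)"
  have neg: "?S (- int j) = flip (coset_diagram t w j)" "?S (int j) = coset_diagram t w j"
    if "j \<ge> 1" for j
    using signed_symbol_at_negative[OF w that] by (simp_all add: coset_diagram_conv_signed)
  note circ = coset_diagram_eq_Circ_iff[OF w]
  show False
  proof (cases l)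
    case (Unprimed i)
    then have i: "i \<ge> 1" and "x = int i \<and> y = int i + 1 \<or> x = - int (i + 1) \<and> y = - int i"
      using inv by auto
    moreover from this have "simple_refl l x = y" "simple_refl l y = x"
      using Unprimed by (auto simp: simple_refl.simps transpose_def)
    ultimately have "?S (int i) = ?S (int (i + 1)) \<or> ?S (- int (i + 1)) = ?S (- int i)"
      using same by (elim disjE conjE) (simp_all add: add.commute)
    then have "coset_diagram t w i = coset_diagram t w (i + 1)"
      using neg[OF i] neg[of "i + 1"] flip_eq_iff by (metis le_add2)
    then show False
      using m Unprimed by (simp add: moves_Unprimed)
  next
    case Primed
    have S: "?S 1 = Circ" "?S (-1) = Circ" "?S 2 \<noteq> Circ" "?S (-2) = flip (?S 2)"
      using inv Primed neg[of 1] neg[of 2] circ[of 1] circ[of 2] by auto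
    then show False
      using inv same Primed flip_Circ_iff[of "?S 2"]
      by (cases "?S 2") (auto simp: simple_refl.simps transpose_def)
  next
    case DPrimed
    have S: "?S 1 \<noteq> Circ" "?S 2 \<noteq> Circ" "?S (-1) = flip (?S 1)" "?S (-2) = flip (?S 2)"
      using inv DPrimed neg[of 1] neg[of 2] circ[of 1] circ[of 2] by auto
    have "?S 1 = ?S 2"
      using m S unfolding moves_def DPrimed by (cases "?S 1"; cases "?S 2") auto
    then show False
      using inv same S DPrimed
      by (cases "?S 2") (auto simp: simple_refl.simps transpose_def)
  qed
qed
text \<open>
  If the length attains the lower bound given by the height, then every letter of a reduced word moves
  the diagram. The empty word is increasing on equal symbols, and letters that move the diagram
  preserve this property by \<open>simple_refl_monotone\<close>.
\<close>
lemma length_additive_increasing: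
  assumes t: "valid_pair t" and w: "w \<in> weyl_group t"
    and len: "int (coxeter_length t w) = height t w - height t id"
    and xy: "x \<noteq> 0" "y \<noteq> 0" "x < y"
    and same: "signed_symbol t (w x) = signed_symbol t (w y)"
  shows "w x < w y"
proof -
  obtain ls where ls: "set ls \<subseteq> labels t" "word_product ls = w" "length ls = coxeter_length t w"
    using reduced_word[OF w] by blast
  have "\<forall>x y. x \<noteq> 0 \<longrightarrow> y \<noteq> 0 \<longrightarrow> x < y \<longrightarrow>
      signed_symbol t (word_product ls x) = signed_symbol t (word_product ls y) \<longrightarrow>
      word_product ls x < word_product ls y"
    if "set ls \<subseteq> labels t" "int (length ls) = height t (word_product ls) - height t id" for ls
    using that
  proof (induction ls rule: rev_induct)
    case (snoc l ls)
    let ?v = "word_product ls"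
    have V: "?v \<in> weyl_group t" and l: "l \<in> labels t" and lsl: "set ls \<subseteq> labels t"
      using snoc.prems by (auto intro: word_product_in_weyl_group)
    have "int (length (ls @ [l])) = height t (word_product (ls @ [l])) - height t id"
      by (rule snoc.prems(2))
    then have "int (length ls) + 1 = height t (?v \<circ> simple_refl l) - height t id"
      by simp
    then have m: "moves t ?v l" and h: "int (length ls) = height t ?v - height t id"
      using height_snoc[OF V t l] height_word_product_le[OF t lsl] by (auto split: if_splits)
    have IH: "?v x < ?v y" if "x \<noteq> 0" "y \<noteq> 0" "x < y"
      "signed_symbol t (?v x) = signed_symbol t (?v y)" for x y
      using snoc.IH[OF lsl h] that by blast
    have "?v (simple_refl l x) < ?v (simple_refl l y)"
      if "x \<noteq> 0" "y \<noteq> 0" "x < y"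
      "signed_symbol t (?v (simple_refl l x)) = signed_symbol t (?v (simple_refl l y))" for x y
      using simple_refl_monotone[OF l V that(1-3) m that(4)] that simple_refl_nonzero[OF l]
      by (intro IH) auto
    then show ?case by simp
  qed simp
  from this[OF ls(1)] show ?thesis
    using ls len xy same by auto
qed

text \<open>
  Otherwise \<open>w\<close> and \<open>w \<circ> simple_refl l\<close> would both be increasing on the pair of points that the reflection
  exchanges.
\<close>
lemma edge_moves:
  assumes t: "valid_pair t" and l: "l \<in> labels t"
    and w: "w \<in> min_reps t" and ws: "w \<circ> simple_refl l \<in> min_reps t"
  shows "moves t w l"
proof (rule ccontr)
  assume nm: "\<not> moves t w l"
  have W: "w \<in> weyl_group t" "w \<circ> simple_refl l \<in> weyl_group t"
    using w ws by (auto simp: min_reps_def)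
  let ?x = "root_left l" and ?y = "root_right l"
  have root: "?x \<noteq> 0" "?y \<noteq> 0" "?x < ?y" "simple_refl l ?x = ?y" "simple_refl l ?y = ?x"
    using l by (cases l; cases t; auto simp: simple_refl.simps transpose_def)+
  have same: "signed_symbol t (w ?x) = signed_symbol t (w ?y)"
    using nm by (simp add: moves_def)
  have "w ?x < w ?y"
    using length_additive_increasing[OF t W(1) min_reps_length[OF t w] root(1-3) same] .
  moreover have "(w \<circ> simple_refl l) ?x < (w \<circ> simple_refl l) ?y"
    using same root by (intro length_additive_increasing[OF t W(2) min_reps_length[OF t ws]]) auto
  ultimately show False using root by simp
qed

lemma bruhat_less_imp_length_less:
  assumes "bruhat_less t u v"
  shows "coxeter_length t u < coxeter_length t v"
  using assms unfolding bruhat_less_def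
  by (induction rule: tranclp_induct) (auto simp: bruhat_step_def)

text \<open>
  A simple reflection is one step of the Bruhat order, in the direction of the greater length.
\<close>
lemma bruhat_less_snoc_iff:
  assumes "w \<in> weyl_group t" "l \<in> labels t"
  shows "bruhat_less t w (w \<circ> simple_refl l) \<longleftrightarrow>
           coxeter_length t w < coxeter_length t (w \<circ> simple_refl l)"
    and "bruhat_less t (w \<circ> simple_refl l) w \<longleftrightarrow>
           coxeter_length t (w \<circ> simple_refl l) < coxeter_length t w"
proof -
  have refl: "simple_refl l \<in> reflections t"
    unfolding reflections_def using assms(2) id_in_weyl_group[of t]
    by (intro CollectI exI[of _ id] exI[of _ l]) auto
  have "bruhat_less t w (w \<circ> simple_refl l)"
    if "coxeter_length t w < coxeter_length t (w \<circ> simple_refl l)"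
    unfolding bruhat_less_def using that assms refl
    by (intro tranclp.r_into_trancl) (auto simp: bruhat_step_def)
  moreover have "bruhat_less t (w \<circ> simple_refl l) w"
    if "coxeter_length t (w \<circ> simple_refl l) < coxeter_length t w"
  proof -
    have "bruhat_step t (w \<circ> simple_refl l) w"
      unfolding bruhat_step_def
      using that assms weyl_group_snoc[OF assms] refl simple_refl_cancel[OF assms(2), of w] by metis
    then show ?thesis
      unfolding bruhat_less_def using tranclp.r_into_trancl[of "bruhat_step t"] by blast
  qed
  ultimately show "bruhat_less t w (w \<circ> simple_refl l) \<longleftrightarrow>
           coxeter_length t w < coxeter_length t (w \<circ> simple_refl l)"
    and "bruhat_less t (w \<circ> simple_refl l) w \<longleftrightarrow>
           coxeter_length t (w \<circ> simple_refl l) < coxeter_length t w"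
    using bruhat_less_imp_length_less by blast+
qed

section \<open>Edges in terms of symbols\<close>
lemma edge_symbols_off:
  assumes e: "(mu, l, nu) \<in> arcs (path_graph t)"
    and j: "j \<ge> 1" "j \<noteq> label_pos l" "j \<noteq> label_pos l + 1"
  shows "coset_diagram t nu j = coset_diagram t mu j"
  using e coset_diagram_snoc_off[OF _ _ j, of mu t] by (auto simp: path_graph_def min_reps_def)

lemma edge_symbols_differ:
  assumes t: "valid_pair t" and e: "(mu, l, nu) \<in> arcs (path_graph t)" and pos: "label_pos l > 1"
  shows "coset_diagram t mu (label_pos l) \<noteq> coset_diagram t mu (label_pos l + 1)"
    and "coset_diagram t nu (label_pos l) \<noteq> coset_diagram t nu (label_pos l + 1)"
proof -
  obtain i where l: "l = Unprimed i" "i > 1"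
    using pos by (cases l) auto
  have "moves t mu l"
    using e by (intro edge_moves[OF t]) (auto simp: path_graph_def)
  then show "coset_diagram t mu (label_pos l) \<noteq> coset_diagram t mu (label_pos l + 1)"
    by (simp add: l moves_Unprimed)
  then show "coset_diagram t nu (label_pos l) \<noteq> coset_diagram t nu (label_pos l + 1)"
    using e l by (auto simp: path_graph_def coset_diagram_Unprimed)
qed

text \<open>
  The right-hand side is the sum of the degrees of the two arcs of the oriented generator, each of which
  has its rightmost vertex at the point \<open>label_pos l + 1\<close>.
\<close>
lemma edge_degree_symbols:
  assumes t: "valid_pair t" and e: "(mu, l, nu) \<in> arcs (path_graph t)"
  shows "edge_degree t (mu, l, nu) =
    of_bool (coset_diagram t nu (label_pos l + 1) = Down)
    - of_bool (coset_diagram t mu (label_pos l + 1) = Up)"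
proof -
  have l: "l \<in> labels t" and mu: "mu \<in> min_reps t" and ms: "mu \<circ> simple_refl l \<in> min_reps t"
    and nu: "nu = mu \<or> nu = mu \<circ> simple_refl l"
    using e by (auto simp: path_graph_def)
  have W: "mu \<in> weyl_group t" using mu by (simp add: min_reps_def)
  have m: "moves t mu l" using edge_moves[OF t l mu ms] .
  have circ: "coset_diagram t mu (label_pos l + 1) \<noteq> Circ"
    using coset_diagram_eq_Circ_iff[OF W, of "label_pos l + 1"] label_pos_bounds[OF t l] by simp
  note right = coset_diagram_snoc_right[OF W t l m]
  show ?thesis
  proof (cases "nu = mu")
    case True
    have "int (coxeter_length t (mu \<circ> simple_refl l)) =
        int (coxeter_length t mu) + (if coset_diagram t mu (label_pos l + 1) = Down then 1 else -1)"
      using min_reps_length[OF t mu] min_reps_length[OF t ms] height_snoc[OF W t l] m by simp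
    then show ?thesis
      using True circ bruhat_less_snoc_iff[OF W l]
      by (cases "coset_diagram t mu (label_pos l + 1)") auto
  next
    case False
    then show ?thesis
      using nu circ right by (cases "coset_diagram t mu (label_pos l + 1)") auto
  qed
qed

section \<open>Planar matchings with oriented nested strands\<close>

text \<open>
  Non-crossing and nesting are expressed through this ternary relation on the boundary: \<open>w\<close> lies on the
  side of the strand \<open>{u, v}\<close> that is away from the left edge.
\<close>
definition between :: "nat \<Rightarrow> vertex \<Rightarrow> vertex \<Rightarrow> vertex \<Rightarrow> bool" where
  "between N u v w \<longleftrightarrow>
     boundary_pos N u < boundary_pos N w \<and> boundary_pos N w < boundary_pos N v \<or>
     boundary_pos N v < boundary_pos N w \<and> boundary_pos N w < boundary_pos N u"

definition perfect_matching :: "nat \<Rightarrow> vertex set set \<Rightarrow> bool" where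
  "perfect_matching N S \<longleftrightarrow>
     \<Union> S = vertices N \<and> pairwise disjnt S \<and> (\<forall>s\<in>S. card s = 2)"

text \<open>
  Two properties in one: strands do not cross, and a strand that is separated from the left edge by
  another strand is oriented, where \<open>\<iota>\<close> tells at each vertex whether the arrow points inwards.
\<close>
definition nested_oriented :: "nat \<Rightarrow> (vertex \<Rightarrow> bool) \<Rightarrow> vertex set set \<Rightarrow> bool" where
  "nested_oriented N \<iota> S \<longleftrightarrow> (\<forall>u v w z. {u, v} \<in> S \<longrightarrow> {w, z} \<in> S \<longrightarrow> between N u v w \<longrightarrow>
     between N u v z \<and> \<iota> w \<noteq> \<iota> z)"

abbreviation cup :: "nat \<Rightarrow> vertex set" where
  "cup i \<equiv> {North i, North (i + 1)}"

lemma between_sym: "between N u v w \<longleftrightarrow> between N v u w"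
  by (auto simp: between_def)

lemma boundary_pos_inj_on: "inj_on (boundary_pos N) (vertices N)"
  by (auto simp: inj_on_def vertices_def)

lemma perfect_matching_cases:
  assumes S: "perfect_matching N S" and i: "1 \<le> i" "i < N"
  obtains (loop) R where "S = insert (cup i) R" "\<And>s. s \<in> R \<Longrightarrow> s \<inter> cup i = {}"
  | (join) x y R where
      "S = insert {North i, x} (insert {North (i + 1), y} R)"
      "{North i, x} \<notin> insert {North (i + 1), y} R" "{North (i + 1), y} \<notin> R"
      "x \<in> vertices N" "y \<in> vertices N" "x \<notin> cup i" "y \<notin> cup i" "x \<noteq> y"
      "\<And>s. s \<in> R \<Longrightarrow> s \<inter> {North i, North (i + 1), x, y} = {}"
proof -
  have disj: "s \<inter> s' = {}" if "s \<in> S" "s' \<in> S" "s \<noteq> s'" for s s'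
    using S that unfolding perfect_matching_def pairwise_def disjnt_def by simp
  have partner: "\<exists>x. s = {v, x} \<and> x \<noteq> v" if "s \<in> S" "v \<in> s" for s v
  proof -
    have "card s = 2" using S that by (simp add: perfect_matching_def)
    then obtain a b where "s = {a, b}" "a \<noteq> b" by (auto simp: card_2_iff)
    then show ?thesis using that(2) by (cases "v = a") (auto intro: exI[of _ a] exI[of _ b])
  qed
  have "North i \<in> \<Union> S" "North (i + 1) \<in> \<Union> S"
    using S i by (auto simp: perfect_matching_def vertices_def)
  then obtain s s' where s: "s \<in> S" "North i \<in> s" and s': "s' \<in> S" "North (i + 1) \<in> s'" by blast
  obtain x where x: "s = {North i, x}" "x \<noteq> North i" using partner[OF s] by blast
  obtain y where y: "s' = {North (i + 1), y}" "y \<noteq> North (i + 1)" using partner[OF s'] by blast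
  show ?thesis
  proof (cases "s = s'")
    case True
    then have "x = North (i + 1)" using s'(2) x(1) by auto
    then have cup: "s = cup i" using x(1) by simp
    show ?thesis
    proof (rule loop[of "S - {s}"])
      show "S = insert (cup i) (S - {s})"
        unfolding cup[symmetric] using s(1) by blast
      show "r \<inter> cup i = {}" if "r \<in> S - {s}" for r
        unfolding cup[symmetric] using disj[of r s] s(1) that by simp
    qed
  next
    case False
    then have ss': "s \<inter> s' = {}" using disj[of s s'] s(1) s'(1) by simp
    then have xy: "x \<notin> s'" "y \<notin> s"
      unfolding x(1) y(1) by auto
    show ?thesis
    proof (rule join[of x y "S - {s, s'}"])
      show "S = insert {North i, x} (insert {North (i + 1), y} (S - {s, s'}))"
        unfolding x(1)[symmetric] y(1)[symmetric] using s s' by blast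
      show "{North i, x} \<notin> insert {North (i + 1), y} (S - {s, s'})"
        unfolding x(1)[symmetric] y(1)[symmetric] using False by blast
      show "{North (i + 1), y} \<notin> S - {s, s'}"
        unfolding y(1)[symmetric] by blast
      have "s \<subseteq> vertices N" "s' \<subseteq> vertices N"
        using S s(1) s'(1) by (auto simp: perfect_matching_def)
      then show "x \<in> vertices N" "y \<in> vertices N" using x(1) y(1) by blast+
      show "x \<notin> cup i" "y \<notin> cup i" "x \<noteq> y"
        using xy x y by auto
      show "r \<inter> {North i, North (i + 1), x, y} = {}" if "r \<in> S - {s, s'}" for r
      proof -
        have "r \<inter> s = {}" "r \<inter> s' = {}"
          using disj[of r s] disj[of r s'] s(1) s'(1) that by simp_all
        then show ?thesis
          unfolding x(1) y(1) by auto
      qed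
    qed
  qed
qed

section \<open>Stacking a generator on a tangle\<close>

text \<open>
  Connected components can be guessed: a partition that no edge leaves, and in each of whose blocks all
  elements are connected to a common hub, is the set of components.
\<close>
lemma quotient_rtrancl_eq_partition:
  assumes A: "\<Union> P = A" and disj: "\<And>K L. K \<in> P \<Longrightarrow> L \<in> P \<Longrightarrow> K \<noteq> L \<Longrightarrow> K \<inter> L = {}"
    and ne: "{} \<notin> P" and sym: "sym r"
    and blocks: "\<And>a b. (a, b) \<in> r \<Longrightarrow> \<exists>K\<in>P. a \<in> K \<and> b \<in> K"
    and hub: "\<And>K. K \<in> P \<Longrightarrow> \<exists>h. \<forall>a\<in>K. (a, h) \<in> r\<^sup>*"
  shows "A // r\<^sup>* = P"
proof -
  have class_eq: "r\<^sup>* `` {a} = K" if K: "K \<in> P" "a \<in> K" for K a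
  proof
    show "r\<^sup>* `` {a} \<subseteq> K"
    proof
      fix b assume "b \<in> r\<^sup>* `` {a}"
      then have "(a, b) \<in> r\<^sup>*" by simp
      then show "b \<in> K"
      proof (induction rule: rtrancl_induct)
        case (step b c)
        then obtain L where "L \<in> P" "b \<in> L" "c \<in> L" using blocks by blast
        then show ?case using disj[of K L] K(1) step.IH by blast
      qed (rule K(2))
    qed
    obtain h where h: "\<And>a. a \<in> K \<Longrightarrow> (a, h) \<in> r\<^sup>*" using hub[OF K(1)] by blast
    show "K \<subseteq> r\<^sup>* `` {a}"
    proof
      fix b assume "b \<in> K"
      then have "(h, b) \<in> r\<^sup>*"
        using h sym_rtrancl[OF sym] by (auto dest: symD)
      then show "b \<in> r\<^sup>* `` {a}"
        using h[OF K(2)] by auto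
    qed
  qed
  show ?thesis
  proof
    show "A // r\<^sup>* \<subseteq> P"
      using A class_eq by (auto elim!: quotientE)
    show "P \<subseteq> A // r\<^sup>*"
    proof
      fix K assume K: "K \<in> P"
      then obtain a where a: "a \<in> K" using ne by (metis all_not_in_conv)
      then have "a \<in> A" using A K by blast
      then have "r\<^sup>* `` {a} \<in> A // r\<^sup>*" by (rule quotientI)
      then show "K \<in> A // r\<^sup>*" by (simp only: class_eq[OF K a])
    qed
  qed
qed

text \<open>
  The part of the stacked picture attached to the vertex \<open>v\<close> of the lower tangle: a northern vertex away
  from the cup continues along a vertical strand of the generator to the top line.
\<close>
fun lift :: "nat \<Rightarrow> vertex \<Rightarrow> stack_vertex set" where
  "lift i (South j) = {Bot j}"
| "lift i (North j) = (if j = i \<or> j = i + 1 then {Mid j} else {Mid j, Top j})"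

lemma in_lower_in_lift: "in_lower v \<in> lift i v"
  by (cases v) auto

lemma lift_disjoint: "v \<noteq> w \<Longrightarrow> lift i v \<inter> lift i w = {}"
  by (cases v; cases w) auto

lemma end_vertices_lift: "end_vertices (\<Union> (lift i ` s)) = s - cup i"
proof -
  have "Bot j \<in> lift i v \<longleftrightarrow> v = South j" for j v
    by (cases v) auto
  moreover have "Top j \<in> lift i v \<longleftrightarrow> v = North j \<and> j \<noteq> i \<and> j \<noteq> i + 1" for j v
    by (cases v) auto
  ultimately show ?thesis
    unfolding end_vertices_def by (auto simp: Bex_def) (metis vertex.exhaust)+
qed

text \<open>
  The strands \<open>Q\<close> of \<open>d\<close> ending at the northern vertices \<open>i\<close> and \<open>i+1\<close> are glued into one component, with the
  set \<open>J\<close> of the remaining ends; the strands \<open>R\<close> are merely prolonged, and the upper arc of the generator is a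
  component by itself. The cases of a closed loop (\<open>J = {}\<close>) and of two strands being joined are
  covered together.
\<close>
lemma components_cup_cap:
  assumes i: "1 \<le> i" "i < N"
    and S: "strands d = Q \<union> R" "\<Union> (Q \<union> R) = vertices N"
    and Q: "\<Union> Q = cup i \<union> J" and J: "\<And>x. x \<in> J \<Longrightarrow> \<exists>c\<in>cup i. {c, x} \<in> Q"
    and R: "pairwise disjnt R" "\<And>s. s \<in> R \<Longrightarrow> s \<inter> (cup i \<union> J) = {}" "{} \<notin> R"
  shows "components d (cup_cap N i b) =
    insert {Top i, Top (i + 1)}
      (insert (\<Union> (lift i ` (cup i \<union> J))) ((\<lambda>s. \<Union> (lift i ` s)) ` R))"
proof -
  define L where "L s = \<Union> (lift i ` s)" for s
  define C where "C = cup i \<union> J"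
  define P where "P = insert {Top i, Top (i + 1)} (insert (L C) (L ` R))"
  let ?U = "strands (cup_cap N i b)"
  define r where "r = {(a, b'). (\<exists>s\<in>strands d. {a, b'} \<subseteq> in_lower ` s) \<or>
                              (\<exists>s\<in>?U. {a, b'} \<subseteq> in_upper ` s)}"
  have U: "?U = {cup i, {South i, South (i + 1)}} \<union> (\<lambda>j. {North j, South j}) ` ({1..N} - {i, i + 1})"
    by (simp add: cup_cap_def)
  have sym: "sym r"
    unfolding r_def sym_def by auto
  have r_lower: "(in_lower u, in_lower v) \<in> r" if "s \<in> strands d" "u \<in> s" "v \<in> s" for s u v
    unfolding r_def using that by auto
  have r_upper: "(in_upper u, in_upper v) \<in> r" if "s \<in> ?U" "u \<in> s" "v \<in> s" for s u v
    unfolding r_def using that by auto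
  have L_mono: "L s \<subseteq> L s'" if "s \<subseteq> s'" for s s'
    unfolding L_def using that by (intro Union_mono image_mono)
  have lift_L: "lift i v \<subseteq> L s" if "v \<in> s" for v s
    unfolding L_def using that by (rule UN_upper)
  have lower_L: "in_lower v \<in> L s" if "v \<in> s" for v s
    using in_lower_in_lift lift_L[OF that] by (rule subsetD[rotated])
  have cover: "\<Union> Q \<union> \<Union> R = vertices N" "\<Union> Q = C"
    using S(2) Q by (simp_all add: C_def Union_Un_distrib)
  have L_all: "L C \<union> \<Union> (L ` R) = L (vertices N)"
    unfolding cover(1)[symmetric] cover(2) L_def by blast
  have blocks_L: "\<exists>K\<in>P. L s \<subseteq> K" if "s \<in> strands d" for s
  proof (cases "s \<in> R")
    case False
    then have "s \<subseteq> C" using that S(1) cover(2) by auto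
    then show ?thesis using L_mono[of s C] by (auto simp: P_def)
  qed (auto simp: P_def)
  have "\<Union> ((`) in_lower ` strands d) \<union> \<Union> ((`) in_upper ` ?U) = \<Union> P"
  proof -
    have lower: "\<Union> ((`) in_lower ` strands d) = in_lower ` vertices N"
      unfolding S(1) S(2)[symmetric] by (rule image_Union[symmetric])
    have "\<Union> ?U = vertices N"
      unfolding U vertices_def using i by auto
    then have upper: "\<Union> ((`) in_upper ` ?U) = in_upper ` vertices N"
      by (simp only: image_Union[symmetric])
    have "\<Union> P = {Top i, Top (i + 1)} \<union> (L C \<union> \<Union> (L ` R))"
      unfolding P_def by simp
    also have "\<dots> = {Top i, Top (i + 1)} \<union> L (vertices N)"
      by (simp only: L_all)
    also have "\<dots> = in_lower ` vertices N \<union> in_upper ` vertices N"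
      using i unfolding vertices_def L_def by (auto simp: image_Un image_image split: if_splits)
    finally show ?thesis
      using lower upper by simp
  qed
  moreover have "\<Union> P // r\<^sup>* = P"
  proof (rule quotient_rtrancl_eq_partition[OF refl _ _ sym])
    have top: "{Top i, Top (i + 1)} \<inter> L s = {}" for s
    proof -
      have "Top i \<notin> lift i v" "Top (i + 1) \<notin> lift i v" for v by (cases v; simp)+
      then show ?thesis unfolding L_def by simp
    qed
    have L_disj: "L s \<inter> L s' = {}" if "s \<inter> s' = {}" for s s'
    proof (rule equals0I)
      fix z assume "z \<in> L s \<inter> L s'"
      then obtain v w where vw: "v \<in> s" "w \<in> s'" "z \<in> lift i v" "z \<in> lift i w"
        unfolding L_def by blast
      then have "v \<noteq> w" using that by blast
      then show False using lift_disjoint[of v w i] vw(3,4) by blast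
    qed
    have RR: "L s \<inter> L s' = {}" if "s \<in> R" "s' \<in> R" "L s \<noteq> L s'" for s s'
      using R(1) that by (intro L_disj) (metis pairwise_def disjnt_def)
    have RC: "L s \<inter> L C = {}" if "s \<in> R" for s
      using R(2)[OF that] unfolding C_def[symmetric] by (rule L_disj)
    show "K \<inter> K' = {}" if KP: "K \<in> P" "K' \<in> P" "K \<noteq> K'" for K K'
    proof -
      have form: "X = {Top i, Top (i + 1)} \<or> (\<exists>s\<in>insert C R. X = L s)" if "X \<in> P" for X
        using that unfolding P_def by blast
      have LL: "L s \<inter> L s' = {}" if "s \<in> insert C R" "s' \<in> insert C R" "L s \<noteq> L s'" for s s'
        using that RR[of s s'] RC[of s] RC[of s'] by (metis Int_commute insertE)
      from form[OF KP(1)] show ?thesis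
      proof (elim disjE bexE)
        assume K: "K = {Top i, Top (i + 1)}"
        then obtain s' where "K' = L s'" using form[OF KP(2)] KP(3) by blast
        then show ?thesis using top[of s'] unfolding K by simp
      next
        fix s assume s: "s \<in> insert C R" and K: "K = L s"
        from form[OF KP(2)] show ?thesis
        proof (elim disjE bexE)
          assume "K' = {Top i, Top (i + 1)}"
          then show ?thesis using top[of s] unfolding K by (simp only: Int_commute)
        next
          fix s' assume "s' \<in> insert C R" "K' = L s'"
          then show ?thesis using LL[OF s, of s'] KP(3) unfolding K by simp
        qed
      qed
    qed
    have "lift i v \<noteq> {}" for v by (cases v) auto
    then have "L s \<noteq> {}" if "s \<noteq> {}" for s
      unfolding L_def using that by auto
    moreover have "C \<noteq> {}" unfolding C_def by simp
    ultimately show "{} \<notin> P" using R(3) unfolding P_def by (metis image_iff insertE insert_not_empty)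
    show "\<exists>K\<in>P. a \<in> K \<and> b \<in> K" if "(a, b) \<in> r" for a b
    proof -
      from that consider s where "s \<in> strands d" "{a, b} \<subseteq> in_lower ` s"
        | s where "s \<in> ?U" "{a, b} \<subseteq> in_upper ` s"
        unfolding r_def by blast
      then show ?thesis
      proof cases
        case 1
        then have "a \<in> L s" "b \<in> L s"
          using lower_L by auto
        then show ?thesis using blocks_L[OF 1(1)] by blast
      next
        case 2
        from 2(1) consider "s = cup i" | "s = {South i, South (i + 1)}"
          | j where "j \<in> {1..N}" "j \<noteq> i" "j \<noteq> i + 1" "s = {North j, South j}"
          unfolding U by blast
        then show ?thesis
        proof cases
          case 1
          then show ?thesis using 2(2) by (auto simp: P_def)
        next
          case 2
          then have "in_upper ` s = {Mid i, Mid (i + 1)}" by simp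
          moreover have "Mid i \<in> L C" "Mid (i + 1) \<in> L C"
            using lower_L[of "North i" C] lower_L[of "North (i + 1)" C] by (simp_all add: C_def)
          ultimately have "a \<in> L C" "b \<in> L C"
            using \<open>{a, b} \<subseteq> in_upper ` s\<close> by auto
          then show ?thesis by (auto simp: P_def)
        next
          case 3
          then have "North j \<in> vertices N" by (auto simp: vertices_def)
          then obtain s' where s': "s' \<in> strands d" "North j \<in> s'"
            using S by (metis UnionE)
          have "in_upper ` s = lift i (North j)" using 3 by auto
          then have "{a, b} \<subseteq> L s'"
            using 2(2) lift_L[OF s'(2)] by (metis subset_trans)
          then show ?thesis using blocks_L[OF s'(1)] by blast
        qed
      qed
    qed
    have via: "(a, in_lower v) \<in> r\<^sup>*" if av: "a \<in> lift i v" "v \<in> vertices N" for a v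
    proof (cases "a = in_lower v")
      case False
      then obtain j where j: "v = North j" "a = Top j" "j \<noteq> i" "j \<noteq> i + 1"
        using av(1) False by (cases v) (auto split: if_splits)
      then have "{North j, South j} \<in> ?U"
        using av(2) unfolding U vertices_def by auto
      then have "(a, in_lower v) \<in> r"
        using r_upper[of "{North j, South j}" "North j" "South j"] j by simp
      then show ?thesis ..
    qed simp
    have hubI: "\<exists>h. \<forall>a\<in>L s. (a, h) \<in> r\<^sup>*"
      if "s \<subseteq> vertices N" "\<And>v. v \<in> s \<Longrightarrow> (in_lower v, h) \<in> r\<^sup>*" for s h
    proof (intro exI[of _ h] ballI)
      fix a assume "a \<in> L s"
      then obtain v where v: "v \<in> s" "a \<in> lift i v" unfolding L_def by blast
      then have "(a, in_lower v) \<in> r\<^sup>*" using that(1) by (intro via) auto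
      then show "(a, h) \<in> r\<^sup>*" using that(2)[OF v(1)] by (rule rtrancl_trans)
    qed
    show "\<exists>h. \<forall>a\<in>K. (a, h) \<in> r\<^sup>*" if K: "K \<in> P" for K
    proof -
      from K consider "K = {Top i, Top (i + 1)}" | "K = L C" | s where "s \<in> R" "K = L s"
        unfolding P_def by blast
      then show ?thesis
      proof cases
        case 1
        have "(Top (i + 1), Top i) \<in> r"
          using r_upper[of "cup i" "North (i + 1)" "North i"] U by simp
        then show ?thesis using 1 by (intro exI[of _ "Top i"]) auto
      next
        case 2
        have mid: "(Mid (i + 1), Mid i) \<in> r"
          using r_upper[of "{South i, South (i + 1)}" "South (i + 1)" "South i"] U by simp
        have cup_hub: "(in_lower c, Mid i) \<in> r\<^sup>*" if "c \<in> cup i" for c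
          using that mid by auto
        have "(in_lower v, Mid i) \<in> r\<^sup>*" if v: "v \<in> C" for v
        proof (cases "v \<in> cup i")
          case False
          then have "v \<in> J" using v unfolding C_def by blast
          then obtain c where c: "c \<in> cup i" "{c, v} \<in> Q" using J by blast
          then have "(in_lower v, in_lower c) \<in> r"
            using r_lower[of "{c, v}" v c] S(1) by simp
          then show ?thesis
            using cup_hub[OF c(1)] by (rule converse_rtrancl_into_rtrancl)
        qed (rule cup_hub)
        moreover have "C \<subseteq> vertices N"
          using cover by blast
        ultimately show ?thesis
          unfolding 2 by (intro hubI)
      next
        case 3
        then obtain u where u: "u \<in> s" using R(3) by (metis all_not_in_conv)
        have "s \<in> strands d" using 3(1) S(1) by blast
        then have "(in_lower v, in_lower u) \<in> r\<^sup>*" if "v \<in> s" for v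
          using r_lower[OF _ that u] by blast
        moreover have "s \<subseteq> vertices N" using 3(1) cover by blast
        ultimately show ?thesis
          unfolding 3(2) by (intro hubI)
      qed
    qed
  qed
  ultimately have "components d (cup_cap N i b) = P"
    unfolding components_def stack_connected_def r_def[symmetric] by simp
  then show ?thesis
    unfolding P_def L_def C_def .
qed

lemma perfect_matching_rest:
  assumes "perfect_matching N (Q \<union> R)"
  shows "pairwise disjnt R" "{} \<notin> R"
proof -
  show "pairwise disjnt R"
    using assms by (auto simp: perfect_matching_def pairwise_def)
  have "card s = 2" if "s \<in> R" for s
    using assms that by (simp add: perfect_matching_def)
  then show "{} \<notin> R" by force
qed

lemma open_strands_conv_components:
  "open_strands d d' = end_vertices ` components d d' - {{}}"
  unfolding open_strands_def closed_components_def by auto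

lemma open_strands_loop:
  assumes S: "perfect_matching N (strands d)" and i: "1 \<le> i" "i < N"
    and R: "strands d = insert (cup i) R" "\<And>s. s \<in> R \<Longrightarrow> s \<inter> cup i = {}"
  shows "open_strands d (cup_cap N i b) = insert (cup i) R"
    and "closed_components d (cup_cap N i b) = {{Mid i, Mid (i + 1)}}"
proof -
  define G where "G = (\<lambda>s. \<Union> (lift i ` s)) ` R"
  have S': "perfect_matching N ({cup i} \<union> R)"
    using S R(1) by simp
  note rest = perfect_matching_rest[OF S']
  have "components d (cup_cap N i b) =
      insert {Top i, Top (i + 1)} (insert (\<Union> (lift i ` (cup i \<union> {}))) G)"
    unfolding G_def
  proof (rule components_cup_cap[OF i, where Q = "{cup i}"])
    show "\<Union> ({cup i} \<union> R) = vertices N"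
      using S' by (simp only: perfect_matching_def)
  qed (use R rest(1,2) in auto)
  moreover have "\<Union> (lift i ` (cup i \<union> {})) = {Mid i, Mid (i + 1)}" by auto
  ultimately have comp: "components d (cup_cap N i b) =
      insert {Top i, Top (i + 1)} (insert {Mid i, Mid (i + 1)} G)" by simp
  have ends: "end_vertices (\<Union> (lift i ` s)) = s" if "s \<in> R" for s
    using R(2)[OF that] unfolding end_vertices_lift by blast
  then have G: "end_vertices ` G = R"
    unfolding G_def image_image by simp
  have top: "end_vertices {Top i, Top (i + 1)} = cup i" and mid: "end_vertices {Mid i, Mid (i + 1)} = {}"
    by (auto simp: end_vertices_def)
  have "end_vertices K \<noteq> {}" if "K \<in> G" for K
    using G rest(2) that by (metis imageI)
  then show "closed_components d (cup_cap N i b) = {{Mid i, Mid (i + 1)}}"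
    unfolding closed_components_def comp using top mid by auto
  show "open_strands d (cup_cap N i b) = insert (cup i) R"
    unfolding open_strands_conv_components comp image_insert top mid G using rest(2) by auto
qed

lemma open_strands_join:
  assumes S: "perfect_matching N (strands d)" and i: "1 \<le> i" "i < N"
    and R: "strands d = insert {North i, x} (insert {North (i + 1), y} R)"
      "\<And>s. s \<in> R \<Longrightarrow> s \<inter> {North i, North (i + 1), x, y} = {}"
    and xy: "x \<notin> cup i" "y \<notin> cup i"
  shows "open_strands d (cup_cap N i b) = insert (cup i) (insert {x, y} R)"
    and "closed_components d (cup_cap N i b) = {}"
proof -
  let ?Q = "{{North i, x}, {North (i + 1), y}}"
  define G where "G = (\<lambda>s. \<Union> (lift i ` s)) ` R"
  define K where "K = \<Union> (lift i ` (cup i \<union> {x, y}))"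
  have S': "perfect_matching N (?Q \<union> R)"
    using S R(1) by simp
  note rest = perfect_matching_rest[OF S']
  have comp: "components d (cup_cap N i b) = insert {Top i, Top (i + 1)} (insert K G)"
    unfolding G_def K_def
  proof (rule components_cup_cap[OF i, where Q = ?Q])
    show "\<Union> (?Q \<union> R) = vertices N"
      using S' by (simp only: perfect_matching_def)
    show "s \<inter> (cup i \<union> {x, y}) = {}" if "s \<in> R" for s
      using R(2)[OF that] by auto
  qed (use R(1) rest(1,2) in auto)
  have ends: "end_vertices (\<Union> (lift i ` s)) = s" if "s \<in> R" for s
    using R(2)[OF that] unfolding end_vertices_lift by blast
  then have G: "end_vertices ` G = R"
    unfolding G_def image_image by simp
  have top: "end_vertices {Top i, Top (i + 1)} = cup i"
    by (auto simp: end_vertices_def)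
  have joined: "end_vertices K = {x, y}"
    unfolding K_def end_vertices_lift using xy by auto
  have "end_vertices K' \<noteq> {}" if "K' \<in> G" for K'
    using G rest(2) that by (metis imageI)
  then show "closed_components d (cup_cap N i b) = {}"
    unfolding closed_components_def comp using top joined by auto
  show "open_strands d (cup_cap N i b) = insert (cup i) (insert {x, y} R)"
    unfolding open_strands_conv_components comp image_insert top joined G using rest(2) by auto
qed

section \<open>Preservation of the nesting condition\<close>

text \<open>
  The points \<open>i\<close> and \<open>i+1\<close> are adjacent on the boundary, so no third strand separates them; and a strand
  around them has an end further left, so \<open>i\<close> is not the first point.
\<close>
lemma between_cup:
  assumes "u \<in> vertices N" "v \<in> vertices N" "u \<notin> cup i" "v \<notin> cup i" "1 \<le> i" "i < N"
  shows "between N u v (North i) \<longleftrightarrow> between N u v (North (i + 1))"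
    and "between N u v (North i) \<Longrightarrow> i > 1"
proof -
  have "boundary_pos N u \<noteq> i" "boundary_pos N u \<noteq> i + 1"
    "boundary_pos N v \<noteq> i" "boundary_pos N v \<noteq> i + 1" "boundary_pos N u \<ge> 1" "boundary_pos N v \<ge> 1"
    using assms by (auto simp: vertices_def)
  then show "between N u v (North i) \<longleftrightarrow> between N u v (North (i + 1))"
    and "between N u v (North i) \<Longrightarrow> i > 1"
    unfolding between_def by auto
qed

lemma not_between_cup:
  assumes "{u, v} = cup i"
  shows "\<not> between N u v w"
  using assms by (auto simp: between_def doubleton_eq_iff)

lemma not_between_self: "\<not> between N u v u" "\<not> between N u v v"
  by (auto simp: between_def)

text \<open>
  Seen from \<open>w\<close>, the joined strand is the concatenation of the strand from \<open>x\<close> to \<open>i\<close>, the short step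
  to \<open>i+1\<close> and the strand from \<open>i+1\<close> to \<open>y\<close>, so separation from the left edge adds up modulo two.
\<close>
lemma between_join:
  assumes "x \<in> vertices N" "y \<in> vertices N" "w \<in> vertices N" "i < N"
    "x \<notin> cup i" "y \<notin> cup i" "w \<notin> cup i" "w \<noteq> x" "w \<noteq> y"
  shows "between N x y w \<longleftrightarrow> (between N (North i) x w \<noteq> between N (North (i + 1)) y w)"
proof -
  have inj: "boundary_pos N u = boundary_pos N v \<longleftrightarrow> u = v" if "u \<in> vertices N" "v \<in> vertices N" for u v
    using boundary_pos_inj_on[of N] that by (auto simp: inj_on_def)
  have "boundary_pos N w \<noteq> boundary_pos N x" "boundary_pos N w \<noteq> boundary_pos N y"
    using assms(1-3,8,9) inj by simp_all
  moreover have "boundary_pos N w \<noteq> i" "boundary_pos N w \<noteq> i + 1"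
    using assms(3,4,7) by (cases w; auto simp: vertices_def)+
  ultimately show ?thesis
    unfolding between_def by auto
qed

text \<open>
  A new cup has nothing inside, and if it lies inside another strand then \<open>i > 1\<close>, where the two
  symbols differ.
\<close>
lemma nested_oriented_insert_cup:
  assumes R: "nested_oriented N \<iota> R" "\<And>s. s \<in> R \<Longrightarrow> s \<subseteq> vertices N" "\<And>s. s \<in> R \<Longrightarrow> s \<inter> cup i = {}"
    and i: "1 \<le> i" "i < N" "i > 1 \<Longrightarrow> \<iota> (North i) \<noteq> \<iota> (North (i + 1))"
  shows "nested_oriented N \<iota> (insert (cup i) R)"
  unfolding nested_oriented_def
proof (intro allI impI)
  fix u v w z
  assume uv: "{u, v} \<in> insert (cup i) R" and wz: "{w, z} \<in> insert (cup i) R" and b: "between N u v w"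
  have uvR: "{u, v} \<in> R"
    using uv b not_between_cup[of u v i] by auto
  then have uv': "u \<in> vertices N" "v \<in> vertices N" "u \<notin> cup i" "v \<notin> cup i"
    using R(2,3)[OF uvR] by auto
  show "between N u v z \<and> \<iota> w \<noteq> \<iota> z"
  proof (cases "{w, z} = cup i")
    case True
    then show ?thesis
      using b between_cup[OF uv' i(1,2)] i(3) by (auto simp: doubleton_eq_iff)
  next
    case False
    then show ?thesis
      using uvR wz b R(1) unfolding nested_oriented_def by blast
  qed
qed

lemma nested_oriented_cong:
  assumes "nested_oriented N \<iota> R" "\<And>v. v \<in> \<Union> R \<Longrightarrow> \<iota>' v = \<iota> v"
  shows "nested_oriented N \<iota>' R"
proof -
  have "\<iota>' w = \<iota> w" "\<iota>' z = \<iota> z" if "{w, z} \<in> R" for w z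
    using assms(2) that by blast+
  then show ?thesis
    using assms(1) unfolding nested_oriented_def by metis
qed

text \<open>
  If \<open>{x, y}\<close> lies inside a strand of \<open>R\<close>, then so do both old strands and the cup between them; these are
  oriented, and three orientations compose to one. If a strand of \<open>R\<close> lies inside \<open>{x, y}\<close>, then by
  \<open>between_join\<close> it lies inside one of the two old strands.
\<close>
lemma nested_oriented_join:
  assumes S: "nested_oriented N \<iota> (insert {North i, x} (insert {North (i + 1), y} R))"
    and R: "\<And>s. s \<in> R \<Longrightarrow> s \<subseteq> vertices N"
      "\<And>s. s \<in> R \<Longrightarrow> s \<inter> {North i, North (i + 1), x, y} = {}"
    and xy: "x \<in> vertices N" "y \<in> vertices N" "x \<notin> cup i" "y \<notin> cup i"
    and i: "1 \<le> i" "i < N" "i > 1 \<Longrightarrow> \<iota> (North i) \<noteq> \<iota> (North (i + 1))"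
  shows "nested_oriented N \<iota> (insert {x, y} R)"
proof -
  let ?S = "insert {North i, x} (insert {North (i + 1), y} R)"
  have S': "between N u v z \<and> \<iota> w \<noteq> \<iota> z" if "{u, v} \<in> ?S" "{w, z} \<in> ?S" "between N u v w" for u v w z
    by (rule S[unfolded nested_oriented_def, rule_format, OF that])
  \<comment> \<open>Follow the joined strand from \<open>x\<close> to \<open>y\<close>, and below from \<open>y\<close> to \<open>x\<close>.\<close>
  have far: "between N u v y \<and> \<iota> x \<noteq> \<iota> y" if uv: "{u, v} \<in> R" and b: "between N u v x" for u v
  proof -
    have uv': "u \<in> vertices N" "v \<in> vertices N" "u \<notin> cup i" "v \<notin> cup i"
      using R[OF uv] by auto
    have 1: "between N u v (North i)" "\<iota> x \<noteq> \<iota> (North i)"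
      using S'[of u v x "North i"] uv b by (auto simp: insert_commute)
    have 2: "between N u v (North (i + 1))" "\<iota> (North i) \<noteq> \<iota> (North (i + 1))"
      using between_cup[OF uv' i(1,2)] 1(1) i(3) by auto
    have 3: "between N u v y" "\<iota> (North (i + 1)) \<noteq> \<iota> y"
      using S'[of u v "North (i + 1)" y] uv 2(1) by auto
    show ?thesis using 1 2 3 by auto
  qed
  have far': "between N u v x \<and> \<iota> y \<noteq> \<iota> x" if uv: "{u, v} \<in> R" and b: "between N u v y" for u v
  proof -
    have uv': "u \<in> vertices N" "v \<in> vertices N" "u \<notin> cup i" "v \<notin> cup i"
      using R[OF uv] by auto
    have 1: "between N u v (North (i + 1))" "\<iota> y \<noteq> \<iota> (North (i + 1))"
      using S'[of u v y "North (i + 1)"] uv b by (auto simp: insert_commute)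
    have 2: "between N u v (North i)" "\<iota> (North i) \<noteq> \<iota> (North (i + 1))"
      using between_cup[OF uv' i(1,2)] 1(1) i(3) by auto
    have 3: "between N u v x" "\<iota> (North i) \<noteq> \<iota> x"
      using S'[of u v "North i" x] uv 2(1) by auto
    show ?thesis using 1 2 3 by auto
  qed
  have inner: "between N x y z \<and> \<iota> w \<noteq> \<iota> z" if wz: "{w, z} \<in> R" and b: "between N x y w" for w z
  proof -
    have wz': "w \<in> vertices N" "w \<notin> cup i" "w \<noteq> x" "w \<noteq> y"
      "z \<in> vertices N" "z \<notin> cup i" "z \<noteq> x" "z \<noteq> y"
      using R[OF wz] by auto
    have zw: "{z, w} \<in> R" using wz by (simp add: insert_commute)
    note bw = between_join[OF xy(1,2) wz'(1) i(2) xy(3,4) wz'(2-4)]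
      and bz = between_join[OF xy(1,2) wz'(5) i(2) xy(3,4) wz'(6-8)]
    have a: "between N (North i) x w \<longleftrightarrow> between N (North i) x z"
      "between N (North (i + 1)) y w \<longleftrightarrow> between N (North (i + 1)) y z"
      using S'[of "North i" x w z] S'[of "North i" x z w]
        S'[of "North (i + 1)" y w z] S'[of "North (i + 1)" y z w] wz zw by blast+
    then have "\<iota> w \<noteq> \<iota> z"
      using b bw S'[of "North i" x w z] S'[of "North (i + 1)" y w z] wz by blast
    then show ?thesis using a b bw bz by blast
  qed
  show ?thesis
    unfolding nested_oriented_def
  proof (intro allI impI)
    fix u v w z
    assume uv: "{u, v} \<in> insert {x, y} R" and wz: "{w, z} \<in> insert {x, y} R" and b: "between N u v w"
    consider "{u, v} \<in> R" "{w, z} \<in> R" | "{u, v} \<in> R" "w = x" "z = y" | "{u, v} \<in> R" "w = y" "z = x"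
      | "u = x" "v = y" "{w, z} \<in> R" | "u = y" "v = x" "{w, z} \<in> R"
      | "{u, v} = {x, y}" "{w, z} = {x, y}"
      using uv wz by (auto simp: doubleton_eq_iff)
    then show "between N u v z \<and> \<iota> w \<noteq> \<iota> z"
    proof cases
      case 1
      then show ?thesis using S' b by blast
    next
      case 2
      then show ?thesis using far b by blast
    next
      case 3
      then show ?thesis using far' b by blast
    next
      case 4
      then show ?thesis using inner b by blast
    next
      case 5
      then show ?thesis using inner b between_sym by metis
    next
      case 6
      then show ?thesis using b not_between_self by (auto simp: doubleton_eq_iff)
    qed
  qed
qed

section \<open>Degrees of strands\<close>
lemma strand_degree_north:
  assumes "i \<noteq> j"
  shows "strand_degree t X {North i, North j} = of_bool (symbol_at t X (North (max i j)) = Down)"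
proof -
  have "(THE v. v \<in> {North i, North j} \<and> column v = Max (column ` {North i, North j})) = North (max i j)"
    using assms by (intro the_equality) (auto simp: max_def)
  then show ?thesis
    by (auto simp: strand_degree_def northern_arc_def southern_arc_def Let_def simp del: image_insert)
qed

lemma strand_degree_south:
  assumes "i \<noteq> j"
  shows "strand_degree t X {South i, South j} = - of_bool (symbol_at t X (South (max i j)) = Up)"
proof -
  have "(THE v. v \<in> {South i, South j} \<and> column v = Max (column ` {South i, South j})) = South (max i j)"
    using assms by (intro the_equality) (auto simp: max_def)
  then show ?thesis
    by (auto simp: strand_degree_def northern_arc_def southern_arc_def Let_def simp del: image_insert)
qed

lemma strand_degree_propagating:
  "strand_degree t X {North i, South j} = 0" "strand_degree t X {South j, North i} = 0"
  by (auto simp: strand_degree_def northern_arc_def southern_arc_def Let_def simp del: image_insert)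

lemma strand_degree_cong:
  assumes "card s = 2" "\<And>v. v \<in> s \<Longrightarrow> symbol_at t X v = symbol_at t Y v"
  shows "strand_degree t X s = strand_degree t Y s"
proof -
  obtain u v where s: "s = {u, v}" "u \<noteq> v"
    using assms(1) by (auto simp: card_2_iff)
  have "symbol_at t X u = symbol_at t Y u" "symbol_at t X v = symbol_at t Y v"
    using assms(2) s by auto
  then show ?thesis
    using s(2) unfolding s(1)
    by (cases u; cases v)
       (auto simp: strand_degree_propagating strand_degree_north strand_degree_south max_def)
qed

text \<open>
  Here the southern arc of the generator contributes the subtracted term. If \<open>x\<close> lies to the right of
  \<open>i+1\<close> along the boundary, then the strand at \<open>i+1\<close> is nested in the one at \<open>i\<close> and hence oriented, so
  the symbol at \<open>y\<close> determines the one at \<open>i+1\<close>. If \<open>y\<close> lies to the left of \<open>i\<close>, the roles are exchanged.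
  In the remaining position only the different symbols at \<open>i\<close> and \<open>i+1\<close> matter.
\<close>
lemma strand_degree_join:
  assumes N: "nested_oriented N (\<lambda>v. inward v (symbol_at t X v)) S"
      "{North i, x} \<in> S" "{North (i + 1), y} \<in> S"
    and xy: "x \<in> vertices N" "y \<in> vertices N" "x \<notin> cup i" "y \<notin> cup i" "x \<noteq> y"
    and i: "1 \<le> i" "i < N" "i > 1 \<Longrightarrow> symbol_at t X (North i) \<noteq> symbol_at t X (North (i + 1))"
      "i > 1 \<Longrightarrow> symbol_at t X (North i) \<noteq> Circ" "symbol_at t X (North (i + 1)) \<noteq> Circ"
  shows "strand_degree t X {North i, x} + strand_degree t X {North (i + 1), y}
      - of_bool (symbol_at t X (North (i + 1)) = Up) = strand_degree t X {x, y}"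
proof -
  let ?p = "boundary_pos N" and ?s = "symbol_at t X"
  note nested = N(1)[unfolded nested_oriented_def, rule_format]
  \<comment> \<open>The strand at \<open>i+1\<close> is nested in the strand at \<open>i\<close>.\<close>
  have 1: "i < ?p y \<and> ?p y < ?p x \<and> inward (North (i + 1)) (?s (North (i + 1))) \<noteq> inward y (?s y)"
    if "i + 1 < ?p x"
    using nested[OF N(2,3)] that by (auto simp: between_def)
  \<comment> \<open>The strand at \<open>i\<close> is nested in the strand at \<open>i+1\<close>.\<close>
  have 2: "?p y < ?p x \<and> ?p x < i + 1 \<and> inward (North i) (?s (North i)) \<noteq> inward x (?s x)"
    if "?p y < i"
    using nested[OF N(3,2)] that by (auto simp: between_def)
  have ends: "?p x \<noteq> i" "?p x \<noteq> i + 1" "?p y \<noteq> i" "?p y \<noteq> i + 1" "?p x \<ge> 1" "?p y \<ge> 1"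
    using xy i(1,2) by (auto simp: vertices_def)
  have i1: "i > 1 \<Longrightarrow> (?s (North i) = Down \<longleftrightarrow> ?s (North (i + 1)) = Up)"
    using i(3-5) by (cases "?s (North i)"; cases "?s (North (i + 1))") auto
  have up: "?s (North (i + 1)) = Up \<longleftrightarrow> ?s (North (i + 1)) \<noteq> Down"
    using i(5) by (cases "?s (North (i + 1))") auto
  note deg = strand_degree_propagating strand_degree_north strand_degree_south
  show ?thesis
  proof (cases x; cases y)
    fix p r assume x: "x = North p" and y: "y = North r"
    then have pr: "p \<noteq> i" "p \<noteq> i + 1" "r \<noteq> i" "r \<noteq> i + 1" "p \<noteq> r" "p \<ge> 1" "r \<ge> 1"
      using xy ends by auto
    consider "p > i + 1" | "p < i" "r < i" | "p < i" "r > i + 1"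
      using pr by linarith
    then show ?thesis
    proof cases
      case 1
      then show ?thesis using \<open>i + 1 < ?p x \<Longrightarrow> _\<close> pr up x y by (auto simp: deg max_def)
    next
      case 2
      then show ?thesis using \<open>?p y < i \<Longrightarrow> _\<close> pr up i1 x y by (auto simp: deg max_def)
    next
      case 3
      then show ?thesis using pr up i1 x y by (auto simp: deg max_def)
    qed
  next
    fix p r assume x: "x = North p" and y: "y = South r"
    then have r: "r \<le> N" "p \<ge> 1" "p \<noteq> i" "p \<noteq> i + 1" using xy ends by (auto simp: vertices_def)
    then have "\<not> i + 1 < p" using 1 x y xy by (auto simp: vertices_def)
    then show ?thesis using x y r i1 up by (auto simp: deg max_def)
  next
    fix p r assume x: "x = South p" and y: "y = North r"
    then have "i + 1 < ?p x" using xy i by (auto simp: vertices_def)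
    then show ?thesis using 1 x y up xy by (auto simp: deg max_def)
  next
    fix p r assume x: "x = South p" and y: "y = South r"
    then have "i + 1 < ?p x" using xy i by (auto simp: vertices_def)
    from 1[OF this] have "p < r" "?s (North (i + 1)) \<noteq> Down \<longleftrightarrow> ?s y = Up"
      using x y xy by (auto simp: vertices_def)
    then show ?thesis using x y up by (auto simp: deg max_def)
  qed
qed

section \<open>Homogeneity of the product\<close>
definition planar_oriented :: "pair_type \<Rightarrow> otangle \<Rightarrow> bool" where
  "planar_oriented t X \<longleftrightarrow> perfect_matching (num_points t) (strands (fst (snd X))) \<and>
     nested_oriented (num_points t) (\<lambda>v. inward v (symbol_at t X v)) (strands (fst (snd X)))"

lemma perfect_matching_join:
  assumes S: "perfect_matching N (insert {North i, x} (insert {North (i + 1), y} R))"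
    and R: "\<And>s. s \<in> R \<Longrightarrow> s \<inter> {North i, North (i + 1), x, y} = {}"
    and xy: "x \<notin> cup i" "y \<notin> cup i" "x \<noteq> y"
  shows "perfect_matching N (insert (cup i) (insert {x, y} R))"
  unfolding perfect_matching_def
proof (intro conjI ballI)
  have "\<Union> (insert (cup i) (insert {x, y} R)) =
      \<Union> (insert {North i, x} (insert {North (i + 1), y} R))"
    by auto
  then show "\<Union> (insert (cup i) (insert {x, y} R)) = vertices N"
    using S by (simp only: perfect_matching_def)
  have "pairwise disjnt R" "\<And>s. s \<in> R \<Longrightarrow> card s = 2"
    using S by (simp_all add: perfect_matching_def pairwise_insert)
  moreover have "disjnt (cup i) s" "disjnt {x, y} s" if "s \<in> R" for s
    using R[OF that] by (auto simp: disjnt_def)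
  moreover have "disjnt (cup i) {x, y}"
    using xy by (auto simp: disjnt_def)
  ultimately show "pairwise disjnt (insert (cup i) (insert {x, y} R))"
    and "\<And>s. s \<in> insert (cup i) (insert {x, y} R) \<Longrightarrow> card s = 2"
    using xy(3) by (auto simp: pairwise_insert disjnt_sym)
qed

lemma nested_oriented_subset:
  assumes "nested_oriented N \<iota> S" "R \<subseteq> S"
  shows "nested_oriented N \<iota> R"
  using assms unfolding nested_oriented_def by (meson subsetD)

lemma gen_tangle_cup_cap: "\<exists>b. gen_tangle N l = cup_cap N (label_pos l) b"
  by (cases l) auto

lemma loop_scalar_loop:
  "loop_scalar t mu {Mid i, Mid (i + 1)} =
     Poly_Mapping.single (if coset_diagram t mu (i + 1) = Down then 1 else -1) 1"
proof -
  have "{j. Mid j \<in> {Mid i, Mid (i + 1)}} = {i, i + 1}" by auto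
  then show ?thesis
    by (simp add: loop_scalar_def q_def q_inv_def)
qed

text \<open>
  One step of the path. In the loop case the exponent is \<open>\<plusminus>1\<close> according to the symbol at \<open>i+1\<close>; in the
  other case it is \<open>0\<close>, and the degrees are compared by \<open>strand_degree_join\<close>.
\<close>
lemma glue_edge:
  assumes t: "valid_pair t" and e: "(mu, l, nu) \<in> arcs (path_graph t)"
    and X: "planar_oriented t (lam, d, mu)"
    and d': "strands d' = open_strands d (gen_tangle (num_points t) l)"
  shows "planar_oriented t (lam, d', nu) \<and>
    (\<exists>a. (\<Prod>K\<in>closed_components d (gen_tangle (num_points t) l). loop_scalar t mu K) =
           Poly_Mapping.single a 1 \<and>
         otangle_degree t (lam, d, mu) + edge_degree t (mu, l, nu) =
           otangle_degree t (lam, d', nu) + a)"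
proof -
  let ?N = "num_points t" and ?X = "(lam, d, mu)" and ?Y = "(lam, d', nu)"
  define i where "i = label_pos l"
  define S where "S = strands d"
  define iX where "iX = (\<lambda>v. inward v (symbol_at t ?X v))"
  define iY where "iY = (\<lambda>v. inward v (symbol_at t ?Y v))"
  obtain b where b: "gen_tangle ?N l = cup_cap ?N i b"
    using gen_tangle_cup_cap unfolding i_def by blast
  have l: "l \<in> labels t" and W: "mu \<in> weyl_group t" "nu \<in> weyl_group t"
    using e by (auto simp: path_graph_def min_reps_def)
  have i: "1 \<le> i" "i < ?N"
    using label_pos_bounds[OF t l] by (simp_all add: i_def)
  have S: "perfect_matching ?N S" "nested_oriented ?N iX S"
    using X by (simp_all add: planar_oriented_def S_def iX_def)
  have finS: "finite S"
  proof (rule finite_UnionD)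
    show "finite (\<Union> S)" using S(1) by (simp add: perfect_matching_def vertices_def)
  qed
  have card: "card s = 2" and sub: "s \<subseteq> vertices ?N" if "s \<in> S" for s
    using S(1) that by (auto simp: perfect_matching_def)
  have same: "symbol_at t ?Y v = symbol_at t ?X v" if "v \<in> vertices ?N" "v \<notin> cup i" for v
    using that edge_symbols_off[OF e] by (cases v) (auto simp: vertices_def i_def)
  have not_circ: "coset_diagram t mu (i + 1) \<noteq> Circ"
    "i > 1 \<Longrightarrow> coset_diagram t mu i \<noteq> Circ"
    "coset_diagram t nu (i + 1) \<noteq> Circ" "i > 1 \<Longrightarrow> coset_diagram t nu i \<noteq> Circ"
    using coset_diagram_eq_Circ_iff[OF W(1)] coset_diagram_eq_Circ_iff[OF W(2)] i(1) by auto
  have differ: "coset_diagram t mu i \<noteq> coset_diagram t mu (i + 1)"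
    "coset_diagram t nu i \<noteq> coset_diagram t nu (i + 1)" if "i > 1"
    using edge_symbols_differ[OF t e] that by (auto simp: i_def)
  have cupX: "iX (North i) \<noteq> iX (North (i + 1))" if "i > 1"
    using differ[OF that] not_circ that unfolding iX_def
    by (cases "coset_diagram t mu i"; cases "coset_diagram t mu (i + 1)") auto
  have cupY: "iY (North i) \<noteq> iY (North (i + 1))" if "i > 1"
    using differ[OF that] not_circ that unfolding iY_def
    by (cases "coset_diagram t nu i"; cases "coset_diagram t nu (i + 1)") auto
  have cup_degree: "strand_degree t ?Y (cup i) = of_bool (coset_diagram t nu (i + 1) = Down)"
    "strand_degree t ?X (cup i) = of_bool (coset_diagram t mu (i + 1) = Down)"
    by (simp_all add: strand_degree_north max_def)
  have edge: "edge_degree t (mu, l, nu) = of_bool (coset_diagram t nu (i + 1) = Down)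
      - of_bool (coset_diagram t mu (i + 1) = Up)"
    using edge_degree_symbols[OF t e] by (simp add: i_def)
  have rest: "(\<Sum>s\<in>R. strand_degree t ?Y s) = (\<Sum>s\<in>R. strand_degree t ?X s)"
    if "R \<subseteq> S" "\<And>s. s \<in> R \<Longrightarrow> s \<inter> cup i = {}" for R
  proof (intro sum.cong refl strand_degree_cong card same)
    fix s v assume "s \<in> R" "v \<in> s"
    then show "v \<in> vertices ?N" "v \<notin> cup i"
      using that sub by blast+
  qed (use that in auto)
  from S(1) i show ?thesis
  proof (cases rule: perfect_matching_cases)
    case (loop R)
    have RS: "R \<subseteq> S" using loop(1) by blast
    have C: "cup i \<notin> R" using loop(2) by blast
    have R: "nested_oriented ?N iY R"
    proof (rule nested_oriented_cong[OF nested_oriented_subset[OF S(2) RS]])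
      fix v assume "v \<in> \<Union> R"
      then have v: "v \<in> vertices ?N" "v \<notin> cup i"
        using RS sub loop(2) by blast+
      show "iY v = iX v" using same[OF v] by (simp only: iX_def iY_def)
    qed
    have glued: "open_strands d (cup_cap ?N i b) = insert (cup i) R"
      "closed_components d (cup_cap ?N i b) = {{Mid i, Mid (i + 1)}}"
      by (rule open_strands_loop[OF S(1)[unfolded S_def] i loop(1)[unfolded S_def]], erule loop(2))+
    have S': "strands d' = insert (cup i) R"
      unfolding d' b glued(1) ..
    have "perfect_matching ?N (strands d')"
      using S(1) loop(1) S' by simp
    moreover have "nested_oriented ?N iY (strands d')"
      unfolding S' using R cupY i RS sub loop(2) by (intro nested_oriented_insert_cup) auto
    moreover have "otangle_degree t ?X = of_bool (coset_diagram t mu (i + 1) = Down)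
        + (\<Sum>s\<in>R. strand_degree t ?X s)"
      using C finS cup_degree(2) by (simp add: S_def[symmetric] loop(1))
    moreover have "otangle_degree t ?Y = of_bool (coset_diagram t nu (i + 1) = Down)
        + (\<Sum>s\<in>R. strand_degree t ?X s)"
      using C finS cup_degree(1) rest[OF RS loop(2)] by (simp add: S' loop(1))
    ultimately show ?thesis
      unfolding b glued(2) edge using not_circ(1)
      by (cases "coset_diagram t mu (i + 1)")
         (simp_all add: planar_oriented_def iY_def loop_scalar_loop[simplified] del: otangle_degree.simps edge_degree.simps)
  next
    case (join x y R)
    have RS: "R \<subseteq> S" using join(1) by blast
    have Rcup: "s \<inter> cup i = {}" if "s \<in> R" for s
      using join(9)[OF that] by auto
    have xyS: "{North i, x} \<in> S" "{North (i + 1), y} \<in> S"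
      using join(1) by auto
    have new: "cup i \<notin> insert {x, y} R" "{x, y} \<notin> R"
      using join(6,7) join(9)[of "cup i"] join(9)[of "{x, y}"] by (auto simp: doubleton_eq_iff)
    have R: "nested_oriented ?N iY (insert {x, y} R)"
    proof (rule nested_oriented_cong)
      show "nested_oriented ?N iX (insert {x, y} R)"
      proof (rule nested_oriented_join[OF _ _ _ join(4-7) i])
        show "i > 1 \<Longrightarrow> iX (North i) \<noteq> iX (North (i + 1))" by (rule cupX)
        show "s \<inter> {North i, North (i + 1), x, y} = {}" if "s \<in> R" for s
          using that by (rule join(9))
        show "nested_oriented ?N iX (insert {North i, x} (insert {North (i + 1), y} R))"
          using S(2) unfolding join(1) .
        show "s \<subseteq> vertices ?N" if "s \<in> R" for s
          using sub[of s] RS that by blast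
      qed
      fix v assume "v \<in> \<Union> (insert {x, y} R)"
      then have v: "v \<in> vertices ?N" "v \<notin> cup i"
        using RS sub Rcup join(4-7) by blast+
      show "iY v = iX v" using same[OF v] by (simp only: iX_def iY_def)
    qed
    have glued: "open_strands d (cup_cap ?N i b) = insert (cup i) (insert {x, y} R)"
      "closed_components d (cup_cap ?N i b) = {}"
      by (rule open_strands_join[OF S(1)[unfolded S_def] i join(1)[unfolded S_def] _ join(6,7)],
          erule join(9))+
    have S': "strands d' = insert (cup i) (insert {x, y} R)"
      unfolding d' b glued(1) ..
    have "perfect_matching ?N (strands d')"
      unfolding S' by (rule perfect_matching_join[OF S(1)[unfolded join(1)] _ join(6-8)], erule join(9))
    moreover have "nested_oriented ?N iY (strands d')"
      unfolding S' using R cupY i RS sub Rcup join(4-7) by (intro nested_oriented_insert_cup) auto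
    moreover have "otangle_degree t ?X = strand_degree t ?X {North i, x}
        + (strand_degree t ?X {North (i + 1), y} + (\<Sum>s\<in>R. strand_degree t ?X s))"
      using join(2,3) finS by (simp add: S_def[symmetric] join(1))
    moreover have "otangle_degree t ?Y = of_bool (coset_diagram t nu (i + 1) = Down)
        + (strand_degree t ?X {x, y} + (\<Sum>s\<in>R. strand_degree t ?X s))"
    proof -
      have "strand_degree t ?Y {x, y} = strand_degree t ?X {x, y}"
        using same join(4-8) by (intro strand_degree_cong) auto
      then show ?thesis
        using new finS cup_degree(1) rest[OF RS Rcup] by (simp add: S' join(1))
    qed
    moreover have "strand_degree t ?X {North i, x} + strand_degree t ?X {North (i + 1), y}
        - of_bool (coset_diagram t mu (i + 1) = Up) = strand_degree t ?X {x, y}"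
      using strand_degree_join[of ?N t ?X S i x y] S(2) xyS join(4-8) i differ(1) not_circ
      by (simp add: iX_def)
    ultimately show ?thesis
      unfolding b glued(2) edge
      by (intro conjI exI[of _ 0])
         (simp_all add: planar_oriented_def iY_def del: otangle_degree.simps edge_degree.simps)
  qed
qed

lemma tl_mult_single_basis:
  fixes c :: laurent
  assumes "c \<noteq> 0"
  shows "tl_mult t (Poly_Mapping.single X c) (basis_elt Y) = Poly_Mapping.map ((*) c) (basis_mult t X Y)"
  using assms by (simp add: tl_mult_def basis_elt_def)

lemma mult_edge_elt:
  "tl_mult t (Poly_Mapping.single (lam, d, mu) (Poly_Mapping.single a 1)) (edge_elt t (mu, l, nu)) =
     Poly_Mapping.single (concat_otangle t (lam, d, mu) (mu, gen_tangle (num_points t) l, nu))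
       (Poly_Mapping.single a 1 *
         (\<Prod>K\<in>closed_components d (gen_tangle (num_points t) l). loop_scalar t mu K))"
proof -
  have "Poly_Mapping.single a 1 \<noteq> (0 :: laurent)"
    by (metis lookup_single_eq lookup_zero zero_neq_one)
  then show ?thesis
    by (simp add: tl_mult_single_basis)
qed

text \<open>
  The accumulated product is always a single oriented tangle with a power of \<open>q\<close> as coefficient; the exponent
  is carried along as part of the degree.
\<close>
lemma foldl_edges_homogeneous:
  assumes t: "valid_pair t"
  shows "set es \<subseteq> arcs (path_graph t) \<Longrightarrow> pre_digraph.cas (path_graph t) mu es nu \<Longrightarrow>
    planar_oriented t (lam, d, mu) \<Longrightarrow>
    \<exists>d' a'. foldl (tl_mult t) (Poly_Mapping.single (lam, d, mu) (Poly_Mapping.single a 1))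
                (map (edge_elt t) es) = Poly_Mapping.single (lam, d', nu) (Poly_Mapping.single a' 1) \<and>
      otangle_degree t (lam, d, mu) + a + sum_list (map (edge_degree t) es) =
        otangle_degree t (lam, d', nu) + a'"
proof (induction es arbitrary: d mu a)
  case Nil
  then show ?case
    by (auto simp: pre_digraph.cas.simps)
next
  case (Cons e es)
  obtain mu' l kappa where "e = (mu', l, kappa)" by (cases e)
  with Cons.prems have e: "e = (mu, l, kappa)" and arc: "(mu, l, kappa) \<in> arcs (path_graph t)"
    and es: "set es \<subseteq> arcs (path_graph t)" "pre_digraph.cas (path_graph t) kappa es nu"
    by (auto simp: pre_digraph.cas.simps path_graph_def)
  obtain d1 where d1: "concat_otangle t (lam, d, mu) (mu, gen_tangle (num_points t) l, kappa) = (lam, d1, kappa)"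
    "strands d1 = open_strands d (gen_tangle (num_points t) l)"
    by (simp add: concat_otangle_def Let_def)
  obtain a1 where a1: "planar_oriented t (lam, d1, kappa)"
    "(\<Prod>K\<in>closed_components d (gen_tangle (num_points t) l). loop_scalar t mu K) =
       Poly_Mapping.single a1 1"
    "otangle_degree t (lam, d, mu) + edge_degree t (mu, l, kappa) =
       otangle_degree t (lam, d1, kappa) + a1"
    using glue_edge[OF t arc Cons.prems(3) d1(2)] by blast
  have "tl_mult t (Poly_Mapping.single (lam, d, mu) (Poly_Mapping.single a 1)) (edge_elt t e) =
      Poly_Mapping.single (lam, d1, kappa) (Poly_Mapping.single (a + a1) 1)"
    unfolding e mult_edge_elt d1(1) a1(2) by (simp add: mult_single)
  moreover obtain d' a' where
    "foldl (tl_mult t) (Poly_Mapping.single (lam, d1, kappa) (Poly_Mapping.single (a + a1) 1))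
        (map (edge_elt t) es) = Poly_Mapping.single (lam, d', nu) (Poly_Mapping.single a' 1)"
    "otangle_degree t (lam, d1, kappa) + (a + a1) + sum_list (map (edge_degree t) es) =
        otangle_degree t (lam, d', nu) + a'"
    using Cons.IH[OF es a1(1)] by blast
  ultimately show ?case
    using a1(3) e by (intro exI[of _ d'] exI[of _ a']) (simp del: otangle_degree.simps edge_degree.simps)
qed

text \<open>
  The product along a path starts with the generator of its first edge. Regarding this generator as the
  product of an identity tangle with itself makes the first edge an instance of \<open>glue_edge\<close>.
\<close>
lemma planar_oriented_id_tangle:
  assumes "mu \<in> weyl_group t"
  shows "planar_oriented t (mu, id_tangle (num_points t), mu)"
    and "otangle_degree t (mu, id_tangle (num_points t), mu) = 0"
proof -
  let ?N = "num_points t"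
  let ?S = "(\<lambda>j. {North j, South j}) ` {1..?N}"
  have "perfect_matching ?N ?S"
    by (auto simp: perfect_matching_def vertices_def pairwise_def disjnt_def)
  moreover have "nested_oriented ?N (\<lambda>v. inward v (symbol_at t (mu, id_tangle ?N, mu) v)) ?S"
    unfolding nested_oriented_def
  proof (intro allI impI)
    fix u v w z assume uv: "{u, v} \<in> ?S" and wz: "{w, z} \<in> ?S" and b: "between ?N u v w"
    obtain j where j: "j \<in> {1..?N}" "{u, v} = {North j, South j}" using uv by blast
    obtain k where k: "k \<in> {1..?N}" "{w, z} = {North k, South k}" using wz by blast
    have "j < k"
      using b j k by (auto simp: between_def doubleton_eq_iff)
    then have "coset_diagram t mu k \<noteq> Circ"
      using coset_diagram_eq_Circ_iff[OF assms, of k] j(1) by auto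
    then show "between ?N u v z \<and> inward w (symbol_at t (mu, id_tangle ?N, mu) w)
        \<noteq> inward z (symbol_at t (mu, id_tangle ?N, mu) z)"
      using j k \<open>j < k\<close> by (cases "coset_diagram t mu k") (auto simp: between_def doubleton_eq_iff)
  qed
  ultimately show "planar_oriented t (mu, id_tangle ?N, mu)"
    by (simp add: planar_oriented_def id_tangle_def)
  have "strand_degree t (mu, id_tangle ?N, mu) s = 0" if "s \<in> ?S" for s
    using that by (auto simp: strand_degree_propagating)
  then show "otangle_degree t (mu, id_tangle ?N, mu) = 0"
    by (simp add: id_tangle_def)
qed

lemma glue_id_tangle:
  assumes i: "1 \<le> i" "i < N"
  shows "open_strands (id_tangle N) (cup_cap N i b) = strands (cup_cap N i b)"
    and "closed_components (id_tangle N) (cup_cap N i b) = {}"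
proof -
  let ?R = "(\<lambda>j. {North j, South j}) ` ({1..N} - {i, i + 1})"
  have S: "perfect_matching N (strands (id_tangle N))"
    by (auto simp: id_tangle_def perfect_matching_def vertices_def pairwise_def disjnt_def)
  have "{1..N} = insert i (insert (i + 1) ({1..N} - {i, i + 1}))"
    using i by auto
  then have R: "strands (id_tangle N) =
      insert {North i, South i} (insert {North (i + 1), South (i + 1)} ?R)"
    unfolding id_tangle_def tangle.sel by (metis (no_types, lifting) image_insert)
  have disj: "s \<inter> {North i, North (i + 1), South i, South (i + 1)} = {}" if "s \<in> ?R" for s
    using that by auto
  have "South i \<notin> cup i" "South (i + 1) \<notin> cup i" by auto
  note glued = open_strands_join[OF S i R _ this, of b]
  show "open_strands (id_tangle N) (cup_cap N i b) = strands (cup_cap N i b)"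
    using glued(1)[OF disj] unfolding cup_cap_def by simp
  show "closed_components (id_tangle N) (cup_cap N i b) = {}"
    using disj by (rule glued(2))
qed

theorem theorem7p1:
  fixes t :: pair_type and T :: "welt \<times> edge awalk" and lam mu :: welt and d :: tangle
  assumes "valid_pair t"
    and "T \<in> paths t"
    and "(lam, d, mu) \<in> ODT t"
    and "basis_elt (lam, d, mu) = path_elt t T"
  shows "otangle_degree t (lam, d, mu) = path_degree t T"
proof -
  obtain u p where T: "T = (u, p)" by (cases T)
  obtain v where walk: "pre_digraph.awalk (path_graph t) u p v"
    using assms(2) T by (auto simp: paths_def)
  then have u: "u \<in> weyl_group t" and p: "set p \<subseteq> arcs (path_graph t)"
    "pre_digraph.cas (path_graph t) u p v"
    by (auto simp: pre_digraph.awalk_def path_graph_def min_reps_def)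
  have inj: "X = Y \<and> a = 0"
    if "basis_elt X = Poly_Mapping.single Y (Poly_Mapping.single a 1 :: laurent)" for X Y a
  proof -
    have "Poly_Mapping.single a 1 \<noteq> (0 :: laurent)"
      by (metis lookup_single_eq lookup_zero zero_neq_one)
    then have "X = Y"
      using arg_cong[OF that, of Poly_Mapping.keys] by (simp add: basis_elt_def)
    moreover from this have one: "(1 :: laurent) = Poly_Mapping.single a 1"
      using arg_cong[OF that, of "\<lambda>z. Poly_Mapping.lookup z X"] by (simp add: basis_elt_def)
    moreover have "a = 0"
      using arg_cong[OF one, of Poly_Mapping.keys] by simp
    ultimately show ?thesis by simp
  qed
  show ?thesis
  proof (cases p)
    case Nil
    have "basis_elt (lam, d, mu) =
        Poly_Mapping.single (u, id_tangle (num_points t), u) (Poly_Mapping.single 0 1)"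
      using assms(4) T Nil by (simp add: basis_elt_def)
    then have "(lam, d, mu) = (u, id_tangle (num_points t), u)"
      using inj by blast
    then show ?thesis
      using planar_oriented_id_tangle(2)[OF u] T Nil by (simp add: path_degree_def del: otangle_degree.simps)
  next
    case (Cons e es)
    obtain u' l kappa where "e = (u', l, kappa)" by (cases e)
    with Cons p have e: "e = (u, l, kappa)" and arc: "(u, l, kappa) \<in> arcs (path_graph t)"
      and es: "set es \<subseteq> arcs (path_graph t)" "pre_digraph.cas (path_graph t) kappa es v"
      by (auto simp: pre_digraph.cas.simps path_graph_def)
    let ?g = "gen_tangle (num_points t) l"
    have l: "l \<in> labels t" using arc by (auto simp: path_graph_def)
    obtain b where b: "?g = cup_cap (num_points t) (label_pos l) b"
      using gen_tangle_cup_cap by blast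
    note glue = glue_id_tangle[OF label_pos_bounds[OF assms(1) l], of b, folded b]
    have good: "planar_oriented t (u, ?g, kappa)"
      and deg: "edge_degree t e = otangle_degree t (u, ?g, kappa)"
    proof -
      from glue_edge[OF assms(1) arc planar_oriented_id_tangle(1)[OF u] glue(1)[symmetric]]
      obtain a where a: "planar_oriented t (u, ?g, kappa)"
        "(1 :: laurent) = Poly_Mapping.single a 1"
        "edge_degree t (u, l, kappa) = otangle_degree t (u, ?g, kappa) + a"
        unfolding glue(2) planar_oriented_id_tangle(2)[OF u] by auto
      have "a = 0"
        using arg_cong[OF a(2), of Poly_Mapping.keys] by simp
      then show "planar_oriented t (u, ?g, kappa)" "edge_degree t e = otangle_degree t (u, ?g, kappa)"
        using a(1,3) e by simp_all
    qed
    obtain d' a where d': "path_elt t T = Poly_Mapping.single (u, d', v) (Poly_Mapping.single a 1)"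
      "otangle_degree t (u, ?g, kappa) + 0 + sum_list (map (edge_degree t) es) =
         otangle_degree t (u, d', v) + a"
      using foldl_edges_homogeneous[OF assms(1) es good, of 0] T Cons e
      by (auto simp: basis_elt_def simp del: otangle_degree.simps edge_degree.simps)
    have "(lam, d, mu) = (u, d', v)" "a = 0"
      using inj assms(4) unfolding d'(1) by blast+
    then show ?thesis
      using d'(2) deg T Cons by (simp add: path_degree_def del: otangle_degree.simps)
  qed
qed

end
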